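(* Let $n,d\in\mathbb{N}$ and $m\in\mathbb{N}_0$, and let $\mathbf{Y}^{(1)},\dots,\mathbf{Y}^{(n)}$ be $m$-dependent Bernoulli random vectors with $$\mathbb{P}(\mathbf{Y}^{(r)}=\mathbf{e}_j)=p_{r,j}\in[0,1],\qquad \mathbb{P}(\mathbf{Y}^{(r)}=\mathbf{0})=1-\sum_{j=1}^d p_{r,j}\in[0,1],\qquad r=1,\dots,n,\ j=1,\dots,d.$$ Let $\mathbf{X}=\sum_{r=1}^n\mathbf{Y}^{(r)}$, and let $\mathbf{P}=(P_1,\dots,P_d)$ be a Poisson random vector with mean $\mathbb{E}[\mathbf{P}]=(\lambda_1,\dots,\lambda_d)$, where $\lambda_j=\sum_{r=1}^n p_{r,j}$ for $j=1,\dots,d$. For $k=1,\dots,n$ let $$Q(k)=\max_{\substack{r\in\{1,\dots,n\}:\,1\le|k-r|\le m\\ i,j=1,\dots,d}}\mathbb{E}\big[\mathbf{1}\{\mathbf{Y}^{(k)}=\mathbf{e}_i\}\mathbf{1}\{\mathbf{Y}^{(r)}=\mathbf{e}_j\}\big],$$ with $Q(k)=0$ if there is no such $r$. Then $$d_W(\mathbf{X},\mathbf{P})\le\sum_{k=1}^n\sum_{i=1}^d\Bigg[\sum_{\substack{r=1,\dots,n\\ |r-k|\le m}}p_{r,i}+2\sum_{j=1}^{i-1}\sum_{\substack{r=1,\dots,n\\ |r-k|\le m}}p_{r,j}\Bigg]p_{k,i}+2d(d+1)m\sum_{k=1}^nQ(k).$$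
   Context: $\mathbb{N}_0=\mathbb{N}\cup\{0\}$. $\mathbf{e}_j\in\mathbb{R}^d$ denotes the vector with entry $1$ at position $j$ and $0$ otherwise. The vectors $\mathbf{Y}^{(1)},\dots,\mathbf{Y}^{(n)}$ are $m$-dependent if for any two subsets $S,T$ of $\{1,\dots,n\}$ with $\min(S)-\max(T)>m$, the collections $(\mathbf{Y}^{(s)})_{s\in S}$ and $(\mathbf{Y}^{(t)})_{t\in T}$ are independent. A Poisson random vector is a random vector with independent, Poisson distributed components (a Poisson variable with mean $0$ is almost surely $0$). For integrable random vectors $\mathbf{X},\mathbf{Y}$ in $\mathbb{N}_0^d$, $d_W(\mathbf{X},\mathbf{Y})=\sup_{g}|\mathbb{E}[g(\mathbf{X})]-\mathbb{E}[g(\mathbf{Y})]|$, the supremum being over all $g:\mathbb{N}_0^d\to\mathbb{R}$ with $|g(\mathbf{x})-g(\mathbf{y})|\le\sum_{i=1}^d|x_i-y_i|$ for all $\mathbf{x},\mathbf{y}\in\mathbb{N}_0^d$. *)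

theory Defs
  imports "HOL-Probability.Probability"
begin

text \<open>
  A vector in \<open>\<nat>\<^sub>0\<^sup>d\<close> is a function on \<open>{1..d}\<close>, extensional (\<open>undefined\<close>) outside of \<open>{1..d}\<close>.
  Since \<open>\<nat>\<^sub>0\<^sup>d\<close> is countable, the product \<open>\<sigma>\<close>-algebra is the discrete one, so every
  real function on \<open>space (nvec d)\<close> is measurable.
\<close>

definition nvec :: "nat \<Rightarrow> (nat \<Rightarrow> nat) measure" where
  "nvec d = PiM {1..d} (\<lambda>_. count_space UNIV)"

definition zero_vec :: "nat \<Rightarrow> nat \<Rightarrow> nat" where
  "zero_vec d = (\<lambda>i\<in>{1..d}. 0)"

definition basis_vec :: "nat \<Rightarrow> nat \<Rightarrow> nat \<Rightarrow> nat" where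
  "basis_vec d j = (\<lambda>i\<in>{1..d}. if i = j then 1 else 0)"

definition sum_vec :: "nat \<Rightarrow> nat \<Rightarrow> (nat \<Rightarrow> 'a \<Rightarrow> nat \<Rightarrow> nat) \<Rightarrow> 'a \<Rightarrow> nat \<Rightarrow> nat" where
  "sum_vec d n Y \<omega> = (\<lambda>i\<in>{1..d}. \<Sum>r=1..n. Y r \<omega> i)"

text \<open>\<open>min S\<close> and \<open>max T\<close> make sense for nonempty sets only; independence from an empty
  collection holds trivially.\<close>

definition m_dependent ::
  "'a measure \<Rightarrow> 'b measure \<Rightarrow> nat \<Rightarrow> nat \<Rightarrow> (nat \<Rightarrow> 'a \<Rightarrow> 'b) \<Rightarrow> bool" where
  "m_dependent M E m n Y \<longleftrightarrow>
    (\<forall>S T. S \<subseteq> {1..n} \<and> T \<subseteq> {1..n} \<and> S \<noteq> {} \<and> T \<noteq> {} \<and> int (Min S) - int (Max T) > int m \<longrightarrow>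
      prob_space.indep_var M
        (PiM S (\<lambda>_. E)) (\<lambda>\<omega>. \<lambda>s\<in>S. Y s \<omega>)
        (PiM T (\<lambda>_. E)) (\<lambda>\<omega>. \<lambda>t\<in>T. Y t \<omega>))"

text \<open>\<^const>\<open>poisson_pmf\<close> is specified for positive rates only.\<close>

definition poisson_law :: "real \<Rightarrow> nat pmf" where
  "poisson_law \<mu> = (if \<mu> = 0 then return_pmf 0 else poisson_pmf \<mu>)"

definition poisson_vector :: "'a measure \<Rightarrow> nat \<Rightarrow> ('a \<Rightarrow> nat \<Rightarrow> nat) \<Rightarrow> bool" where
  "poisson_vector M d P \<longleftrightarrow>
    P \<in> measurable M (nvec d) \<and>
    prob_space.indep_vars M (\<lambda>_. count_space UNIV) (\<lambda>j \<omega>. P \<omega> j) {1..d} \<and>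
    (\<forall>j\<in>{1..d}. \<exists>\<mu>\<ge>0. distr M (count_space UNIV) (\<lambda>\<omega>. P \<omega> j) = measure_pmf (poisson_law \<mu>))"

definition lipschitz1 :: "nat \<Rightarrow> ((nat \<Rightarrow> nat) \<Rightarrow> real) set" where
  "lipschitz1 d = {g. \<forall>x\<in>space (nvec d). \<forall>y\<in>space (nvec d).
     \<bar>g x - g y\<bar> \<le> (\<Sum>i=1..d. \<bar>real (x i) - real (y i)\<bar>)}"

text \<open>
  The Wasserstein distance depends on the laws of the two vectors only, so they may live on
  different probability spaces. It is meant for integrable vectors, for which all the expectations
  exist. The supremum is taken in \<^typ>\<open>ereal\<close>, where it is the least upper bound even without
  a boundedness proof.
\<close>

definition dW ::
  "nat \<Rightarrow> 'a measure \<Rightarrow> ('a \<Rightarrow> nat \<Rightarrow> nat) \<Rightarrow> 'b measure \<Rightarrow> ('b \<Rightarrow> nat \<Rightarrow> nat) \<Rightarrow> ereal" where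
  "dW d M X N Z =
    (SUP g\<in>lipschitz1 d. ereal \<bar>(LINT \<omega>|M. g (X \<omega>)) - (LINT \<omega>|N. g (Z \<omega>))\<bar>)"

definition nbhd :: "nat \<Rightarrow> nat \<Rightarrow> nat \<Rightarrow> nat set" where
  "nbhd n m k = {r\<in>{1..n}. \<bar>int r - int k\<bar> \<le> int m}"

definition Qmax :: "'a measure \<Rightarrow> nat \<Rightarrow> nat \<Rightarrow> nat \<Rightarrow> (nat \<Rightarrow> 'a \<Rightarrow> nat \<Rightarrow> nat) \<Rightarrow> nat \<Rightarrow> real" where
  "Qmax M d n m Y k =
    (let R = {r\<in>{1..n}. 1 \<le> \<bar>int k - int r\<bar> \<and> \<bar>int k - int r\<bar> \<le> int m} in
     if R = {} then 0
     else Max {LINT \<omega>|M. indicator {basis_vec d i} (Y k \<omega>) * indicator {basis_vec d j} (Y r \<omega>)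
               | r i j. r \<in> R \<and> i \<in> {1..d} \<and> j \<in> {1..d}})"

end

theory Submission
  imports Defs
begin

text \<open>
  The coordinates of \<open>X\<close> are replaced by independent Poisson variables one at a time, starting from
  the last one. Replacing coordinate \<open>i\<close> of a 1-Lipschitz function \<open>g\<close> amounts to solving the
  one-dimensional Poisson Stein equation in that coordinate, with the coordinates \<open>j < i\<close> as parameters.
  Its solution \<open>F\<close> satisfies the resolvent equations \<open>(A - 1) F = \<Delta>h\<close> and \<open>(A - 2) \<Delta>F = \<Delta>\<^sup>2h\<close>,
  where \<open>A\<close> is the generator of the immigration-death process, so a maximum principle gives
  Lipschitz constant 1 in coordinate \<open>i\<close> and 2 in the parameters. With \<open>W\<^sub>k\<close> the sum of the vectors
  outside the \<open>m\<close>-neighbourhood of \<open>k\<close>, which is independent of \<open>Y\<^sup>k\<close>, comparing \<open>X\<close> with \<open>W\<^sub>k\<close> yields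
  the bound for each coordinate; the \<open>Q(k)\<close> terms sum up to \<open>2 d\<^sup>2 m\<close> times the sum of the \<open>Q(k)\<close>.
\<close>

section \<open>The Stein equation of the Poisson distribution\<close>

text \<open>The index is shifted: \<open>stein_sol \<mu> k t\<close> is the value at \<open>t + 1\<close> of the usual solution \<open>f\<close> of
  \<open>\<mu> f(t + 1) - t f(t) = k t\<close>, whose value at \<open>0\<close> is arbitrary. The tail series needs no division
  by \<open>\<mu>\<close>, so \<open>\<mu> = 0\<close> is included.\<close>

definition stein_sol :: "real \<Rightarrow> (nat \<Rightarrow> real) \<Rightarrow> nat \<Rightarrow> real" where
  "stein_sol \<mu> k t = - (\<Sum>j. \<mu> ^ j * (fact t / fact (Suc (t + j))) * k (Suc (t + j)))"

section \<open>Series of Poisson weights\<close>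

lemma summable_power_over_fact: "summable (\<lambda>j. \<mu> ^ j / fact j :: real)"
  using summable_exp_generic[of \<mu>] by (simp add: scaleR_conv_of_real field_simps)

lemma suminf_power_over_fact: "(\<Sum>j. \<mu> ^ j / fact j) = exp (\<mu> :: real)"
  unfolding exp_def by (simp add: scaleR_conv_of_real field_simps)

text \<open>The unnormalised Poisson mean: an index shift cancels the factor \<open>j\<close>
  against the factorial. It yields both the mean of \<open>poisson_law\<close> and the summability
  of functions of linear growth.\<close>

lemma sums_nat_times_power_over_fact:
  "(\<lambda>j. real j * (\<mu> ^ j / fact j)) sums (\<mu> * exp \<mu>)"
proof -
  have "(\<lambda>j. \<mu> * (\<mu> ^ j / fact j)) sums (\<mu> * exp \<mu>)"
    using summable_sums[OF summable_power_over_fact[of \<mu>]] suminf_power_over_fact[of \<mu>]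
    by (intro sums_mult) simp
  moreover have "\<mu> * (\<mu> ^ j / fact j) = real (Suc j) * (\<mu> ^ Suc j / fact (Suc j))" for j
    by (simp add: divide_simps del: of_nat_Suc)
  ultimately have "(\<lambda>j. real (Suc j) * (\<mu> ^ Suc j / fact (Suc j))) sums (\<mu> * exp \<mu>)"
    by simp
  then show ?thesis
    by (subst (asm) sums_Suc_iff) simp
qed

lemma summable_linear_growth:
  fixes k :: "nat \<Rightarrow> real"
  assumes "\<mu> \<ge> 0" and k: "\<And>s. \<bar>k s\<bar> \<le> A + B * real s"
  shows "summable (\<lambda>j. norm (\<mu> ^ j / fact j * k j))"
proof (rule summable_comparison_test)
  show "\<exists>N. \<forall>j\<ge>N. norm (norm (\<mu> ^ j / fact j * k j))
      \<le> A * (\<mu> ^ j / fact j) + B * (real j * (\<mu> ^ j / fact j))"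
  proof (intro exI[of _ 0] allI impI)
    fix j
    have "\<mu> ^ j / fact j * \<bar>k j\<bar> \<le> \<mu> ^ j / fact j * (A + B * real j)"
      by (rule mult_left_mono[OF k]) (use assms in simp)
    then show "norm (norm (\<mu> ^ j / fact j * k j))
      \<le> A * (\<mu> ^ j / fact j) + B * (real j * (\<mu> ^ j / fact j))"
      using assms by (simp add: abs_mult algebra_simps add_divide_distrib)
  qed
  show "summable (\<lambda>j. A * (\<mu> ^ j / fact j) + B * (real j * (\<mu> ^ j / fact j)))"
    using sums_summable[OF sums_nat_times_power_over_fact] summable_power_over_fact
    by (intro summable_add summable_mult)
qed

text \<open>Linear growth of \<open>k\<close> costs a factor \<open>Suc (t + j)\<close>, which
  \<open>fact (Suc (t + j))\<close> absorbs; what remains is at most \<open>1 / fact j\<close>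
  because \<open>fact t * fact j\<close> divides \<open>fact (t + j)\<close>. The bound is uniform
  in \<open>t\<close>.\<close>

lemma stein_sol_term_bound:
  fixes k :: "nat \<Rightarrow> real"
  assumes "\<mu> \<ge> 0" "A \<ge> 0" "B \<ge> 0" and k: "\<And>s. \<bar>k s\<bar> \<le> A + B * real s"
  shows "\<bar>\<mu> ^ j * (fact t / fact (Suc (t + j))) * k (Suc (t + j))\<bar> \<le> (A + B) * (\<mu> ^ j / fact j)"
proof -
  have "fact t * fact j \<le> (fact (t + j) :: nat)"
    by (rule dvd_imp_le[OF fact_fact_dvd_fact]) simp
  then have f: "fact t * fact j \<le> (fact (t + j) :: real)"
    by (metis of_nat_fact of_nat_le_iff of_nat_mult)
  have "fact t / fact (Suc (t + j)) * \<bar>k (Suc (t + j))\<bar>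
      \<le> fact t / fact (Suc (t + j)) * ((A + B) * real (Suc (t + j)))"
  proof (rule mult_left_mono)
    have "A * 1 \<le> A * real (Suc (t + j))"
      by (rule mult_left_mono) (use assms in auto)
    then show "\<bar>k (Suc (t + j))\<bar> \<le> (A + B) * real (Suc (t + j))"
      using k[of "Suc (t + j)"] by (simp only: distrib_right)
  qed simp
  also have "\<dots> = (A + B) * (fact t / fact (t + j))"
    by (simp add: divide_simps del: of_nat_Suc)
  also have "\<dots> \<le> (A + B) * (1 / fact j)"
    using f assms by (intro mult_left_mono) (auto simp: divide_simps)
  finally have "\<mu> ^ j * (fact t / fact (Suc (t + j)) * \<bar>k (Suc (t + j))\<bar>) \<le> \<mu> ^ j * ((A + B) * (1 / fact j))"
    by (rule mult_left_mono) (use assms in simp)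
  then show ?thesis
    using assms by (simp add: abs_mult algebra_simps)
qed

text \<open>The constant is crude: it supplies the a priori boundedness that the maximum principle
  asks for, and that principle then gives the sharp constants.\<close>

lemma
  fixes k :: "nat \<Rightarrow> real"
  assumes "\<mu> \<ge> 0" "A \<ge> 0" "B \<ge> 0" and k: "\<And>s. \<bar>k s\<bar> \<le> A + B * real s"
  shows summable_stein_sol:
      "summable (\<lambda>j. \<mu> ^ j * (fact t / fact (Suc (t + j))) * k (Suc (t + j)))"
    and stein_sol_bounded: "\<bar>stein_sol \<mu> k t\<bar> \<le> (A + B) * exp \<mu>"
proof -
  note b = stein_sol_term_bound[where t = t, OF assms]
  have s: "summable (\<lambda>j. norm (\<mu> ^ j * (fact t / fact (Suc (t + j))) * k (Suc (t + j))))"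
    by (rule summable_comparison_test'[where N = 0, OF summable_mult[OF summable_power_over_fact, of "A + B" \<mu>]])
       (use b in simp)
  then show "summable (\<lambda>j. \<mu> ^ j * (fact t / fact (Suc (t + j))) * k (Suc (t + j)))"
    by (rule summable_norm_cancel)
  have "norm (\<Sum>j. \<mu> ^ j * (fact t / fact (Suc (t + j))) * k (Suc (t + j)))
      \<le> (\<Sum>j. (A + B) * (\<mu> ^ j / fact j))"
    using b by (intro norm_suminf_le summable_mult summable_power_over_fact) simp
  also have "\<dots> = (A + B) * exp \<mu>"
    using suminf_mult[OF summable_power_over_fact, of "A + B" \<mu>] suminf_power_over_fact by simp
  finally show "\<bar>stein_sol \<mu> k t\<bar> \<le> (A + B) * exp \<mu>"
    by (simp add: stein_sol_def)
qed

text \<open>Up to sign, \<open>t\<close> times the solution at \<open>t - 1\<close> is the full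
  series of the \<open>a j\<close>, and \<open>\<mu>\<close> times the solution at \<open>t\<close>
  is the same series without \<open>a 0 = k t\<close>. For \<open>t = 0\<close> the full series is
  the Poisson sum, which vanishes by centring.\<close>

lemma stein_equation:
  fixes k :: "nat \<Rightarrow> real"
  assumes "\<mu> \<ge> 0" "A \<ge> 0" "B \<ge> 0" and k: "\<And>s. \<bar>k s\<bar> \<le> A + B * real s"
    and centred: "(\<Sum>j. \<mu> ^ j / fact j * k j) = 0"
  shows "\<mu> * stein_sol \<mu> k t - real t * stein_sol \<mu> k (t - 1) = k t"
proof -
  define a where "a j = \<mu> ^ j * (fact t / fact (t + j)) * k (t + j)" for j
  have step: "\<mu> * (\<mu> ^ j * (fact t / fact (Suc (t + j))) * k (Suc (t + j))) = a (Suc j)" for j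
    by (simp add: a_def)
  note s = summable_stein_sol[where t = t, OF assms(1-4)]
  have "summable (\<lambda>j. a (Suc j))"
    using summable_mult[OF s, of \<mu>] by (simp only: step)
  then have "(\<Sum>j. a (Suc j)) = (\<Sum>j. a j) - a 0"
    by (intro suminf_split_head) (simp add: summable_Suc_iff)
  moreover have "\<mu> * stein_sol \<mu> k t = - (\<Sum>j. a (Suc j))"
    unfolding stein_sol_def using suminf_mult[OF s, of \<mu>] by (simp only: step minus_mult_right)
  moreover have "(\<Sum>j. a j) = - (real t * stein_sol \<mu> k (t - 1))"
  proof (cases t)
    case 0
    then show ?thesis using centred by (simp add: a_def)
  next
    case (Suc u)
    have "real t * (\<mu> ^ j * (fact u / fact (Suc (u + j))) * k (Suc (u + j))) = a j" for j
      by (simp add: a_def Suc)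
    then show ?thesis
      using suminf_mult[OF summable_stein_sol[where t = u, OF assms(1-4)], of "real t"]
      by (simp add: stein_sol_def Suc)
  qed
  ultimately show ?thesis by (simp add: a_def)
qed

text \<open>The tilt by \<open>\<epsilon> t\<close> makes a maximum exist; the linear function has bounded generator
  from above, so the perturbation vanishes with \<open>\<epsilon>\<close>.\<close>

lemma immigration_death_max_principle_upper:
  fixes G r :: "nat \<Rightarrow> real"
  assumes "\<mu> \<ge> 0" "c > 0" and bdd: "\<And>t. \<bar>G t\<bar> \<le> C"
    and eq: "\<And>t. \<mu> * (G (Suc t) - G t) - real t * (G t - G (t - 1)) - c * G t = r t"
    and r: "\<And>t. \<bar>r t\<bar> \<le> K"
  shows "c * G t \<le> K"
proof (rule field_le_epsilon)
  fix e :: real assume "e > 0"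
  \<comment> \<open>The tilt costs \<open>\<mu> * \<epsilon>\<close> at the maximiser and
    \<open>c * \<epsilon> * t\<close> on the way back to \<open>t\<close>. The summand 1 keeps the
    denominator positive even if \<open>\<mu>\<close> and \<open>t\<close> are both 0.\<close>
  define \<epsilon> where "\<epsilon> = e / (\<mu> + c * real t + 1)"
  have den: "\<mu> + c * real t + 1 > 0" using assms(1,2) by (simp add: add_nonneg_pos)
  have \<epsilon>: "\<epsilon> > 0" and \<epsilon>e: "\<epsilon> * (\<mu> + c * real t) \<le> e"
    using \<open>e > 0\<close> den by (auto simp: \<epsilon>_def divide_simps)
  define H where "H s = G s - \<epsilon> * real s" for s
  \<comment> \<open>Every candidate for the maximum of \<open>H\<close> lies in this set, and it is
    finite because \<open>G\<close> is bounded while the tilt decreases without bound.\<close>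
  define S where "S = {s. H s \<ge> H 0}"
  have "S \<subseteq> {..nat \<lceil>2 * C / \<epsilon>\<rceil>}"
  proof
    fix s assume "s \<in> S"
    then have "\<epsilon> * real s \<le> 2 * C"
      using bdd[of s] bdd[of 0] by (simp add: S_def H_def abs_if split: if_splits)
    then have "real s \<le> 2 * C / \<epsilon>" using \<epsilon> by (simp add: field_simps)
    then show "s \<in> {..nat \<lceil>2 * C / \<epsilon>\<rceil>}"
      unfolding atMost_iff by linarith
  qed
  then have fin: "finite S" by (rule finite_subset) simp
  have "0 \<in> S" by (simp add: S_def)
  then have "Max (H ` S) \<in> H ` S" using fin by (intro Max_in) auto
  then obtain s where "s \<in> S" "H s = Max (H ` S)" by auto
  with fin have s: "s \<in> S" "\<And>u. u \<in> S \<Longrightarrow> H u \<le> H s" by simp_all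
  have max: "H u \<le> H s" for u
    using s \<open>0 \<in> S\<close> by (cases "u \<in> S") (fastforce simp: S_def)+
  have "\<mu> * (G (Suc s) - G s) \<le> \<mu> * \<epsilon>"
    using max[of "Suc s"] assms(1) by (intro mult_left_mono) (simp_all add: H_def algebra_simps)
  \<comment> \<open>At a maximiser the death term has the favourable sign; at \<open>s = 0\<close>,
    where \<open>s - 1\<close> truncates, its factor is zero.\<close>
  moreover have "real s * (G s - G (s - 1)) \<ge> 0"
  proof (cases s)
    case (Suc u)
    with max[of u] \<epsilon> show ?thesis by (intro mult_nonneg_nonneg) (simp_all add: H_def algebra_simps)
  qed simp
  ultimately have "c * G s \<le> \<mu> * \<epsilon> + K"
    using eq[of s] r[of s] by linarith
  moreover have "c * G t \<le> c * (G s + \<epsilon> * real t)"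
  proof (rule mult_left_mono)
    have "0 \<le> \<epsilon> * real s" using \<epsilon> by simp
    then show "G t \<le> G s + \<epsilon> * real t" using max[of t] unfolding H_def by linarith
  qed (use assms in simp)
  ultimately show "c * G t \<le> K + e" using \<epsilon>e by (simp add: algebra_simps)
qed

lemma immigration_death_max_principle:
  fixes G r :: "nat \<Rightarrow> real"
  assumes "\<mu> \<ge> 0" "c > 0" and bdd: "\<And>t. \<bar>G t\<bar> \<le> C"
    and eq: "\<And>t. \<mu> * (G (Suc t) - G t) - real t * (G t - G (t - 1)) - c * G t = r t"
    and r: "\<And>t. \<bar>r t\<bar> \<le> K"
  shows "c * \<bar>G t\<bar> \<le> K"
proof -
  have "c * G t \<le> K"
    by (rule immigration_death_max_principle_upper[OF assms])
  moreover have "c * (- G t) \<le> K"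
  proof (rule immigration_death_max_principle_upper[where G = "\<lambda>t. - G t" and r = "\<lambda>t. - r t"])
    show "\<mu> * (- G (Suc t) - - G t) - real t * (- G t - - G (t - 1)) - c * - G t = - r t" for t
      using eq[of t] by (simp add: algebra_simps)
  qed (use assms in auto)
  ultimately show ?thesis by (simp add: abs_if)
qed

text \<open>Differencing \<open>t F(t - 1)\<close> gives \<open>t (F t - F(t - 1)) + F t\<close>.
  The extra \<open>F t\<close> is the killing term of the maximum principle, with rate
  \<open>c = 1\<close>.\<close>

lemma stein_difference_equation:
  fixes F k :: "nat \<Rightarrow> real"
  assumes "\<And>t. \<mu> * F t - real t * F (t - 1) = k t"
  shows "\<mu> * (F (Suc t) - F t) - real t * (F t - F (t - 1)) - F t = k (Suc t) - k t"
  using assms[of t] assms[of "Suc t"] by (simp add: algebra_simps)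

text \<open>The maximum principle with \<open>c = 1\<close>. It is meant for the difference of two
  solutions with different parameters, which again solves a Stein equation.\<close>

lemma stein_bound:
  fixes F k :: "nat \<Rightarrow> real"
  assumes "\<mu> \<ge> 0" and eq: "\<And>t. \<mu> * F t - real t * F (t - 1) = k t"
    and "\<And>t. \<bar>F t\<bar> \<le> C" and "\<And>t. \<bar>k (Suc t) - k t\<bar> \<le> K"
  shows "\<bar>F t\<bar> \<le> K"
proof -
  have "1 * \<bar>F t\<bar> \<le> K"
  proof (rule immigration_death_max_principle[where \<mu> = \<mu> and G = F and r = "\<lambda>t. k (Suc t) - k t"])
    show "\<mu> * (F (Suc t) - F t) - real t * (F t - F (t - 1)) - 1 * F t = k (Suc t) - k t" for t
      using stein_difference_equation[where F = F, OF eq] by simp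
  qed (use assms in auto)
  then show ?thesis by simp
qed

text \<open>A second differencing raises the killing rate to 2, while the second difference of
  \<open>k\<close> is at most \<open>2 * K\<close>; the two factors 2 cancel.\<close>

lemma stein_difference_bound:
  fixes F k :: "nat \<Rightarrow> real"
  assumes "\<mu> \<ge> 0" and eq: "\<And>t. \<mu> * F t - real t * F (t - 1) = k t"
    and F: "\<And>t. \<bar>F t\<bar> \<le> C" and k: "\<And>t. \<bar>k (Suc t) - k t\<bar> \<le> K"
  shows "\<bar>F (Suc t) - F t\<bar> \<le> K"
proof -
  note deq = stein_difference_equation[where F = F, OF eq]
  have "2 * \<bar>F (Suc t) - F t\<bar> \<le> 2 * K"
  proof (rule immigration_death_max_principle[where \<mu> = \<mu> and G = "\<lambda>t. F (Suc t) - F t"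
        and r = "\<lambda>t. (k (Suc (Suc t)) - k (Suc t)) - (k (Suc t) - k t)" and C = "2 * C"])
    show "\<bar>F (Suc t) - F t\<bar> \<le> 2 * C" for t
      using F[of t] F[of "Suc t"] by linarith
    show "\<bar>(k (Suc (Suc t)) - k (Suc t)) - (k (Suc t) - k t)\<bar> \<le> 2 * K" for t
      using k[of t] k[of "Suc t"] by linarith
    \<comment> \<open>For \<open>t = 0\<close> the terms with \<open>t - 1\<close> are multiplied by
      zero; for a successor, \<open>Suc (t - 1)\<close> is \<open>t\<close>.\<close>
    show "\<mu> * ((F (Suc (Suc t)) - F (Suc t)) - (F (Suc t) - F t))
        - real t * ((F (Suc t) - F t) - (F (Suc (t - 1)) - F (t - 1))) - 2 * (F (Suc t) - F t)
      = (k (Suc (Suc t)) - k (Suc t)) - (k (Suc t) - k t)" for t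
      using deq[of t] deq[of "Suc t"] by (cases t) (simp_all add: algebra_simps)
  qed (use assms in auto)
  then show ?thesis by simp
qed

section \<open>Replacing one coordinate by a Poisson variable\<close>

text \<open>Since \<open>0 ^ 0 = 1\<close>, the formula covers the point mass at
  \<open>\<mu> = 0\<close>, so later arguments need no case distinction on the mean.\<close>

lemma pmf_poisson_law:
  assumes "\<mu> \<ge> 0"
  shows "pmf (poisson_law \<mu>) j = exp (- \<mu>) * (\<mu> ^ j / fact j)"
  using assms by (cases j) (auto simp: poisson_law_def)

lemma
  fixes k :: "nat \<Rightarrow> real"
  assumes "\<mu> \<ge> 0" and k: "\<And>s. \<bar>k s\<bar> \<le> A + B * real s"
  shows integrable_poisson_law: "integrable (poisson_law \<mu>) k"
    and integral_poisson_law: "(LINT t|poisson_law \<mu>. k t) = exp (- \<mu>) * (\<Sum>j. \<mu> ^ j / fact j * k j)"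
proof -
  have s: "summable (\<lambda>j. norm (\<mu> ^ j / fact j * k j))"
    by (rule summable_linear_growth[OF assms])
  have e: "pmf (poisson_law \<mu>) j * k j = exp (- \<mu>) * (\<mu> ^ j / fact j * k j)" for j
    using assms by (simp add: pmf_poisson_law)
  have i: "integrable (count_space UNIV) (\<lambda>j. pmf (poisson_law \<mu>) j * k j)"
    using summable_mult[OF s, of "exp (- \<mu>)"]
    unfolding integrable_count_space_nat_iff e by (simp add: abs_mult)
  show "integrable (poisson_law \<mu>) k"
    using i by (simp add: measure_pmf_eq_density integrable_density)
  have "(LINT t|poisson_law \<mu>. k t) = (\<Sum>j. pmf (poisson_law \<mu>) j * k j)"
    using integral_count_space_nat[OF i] by (simp add: measure_pmf_eq_density integral_density)
  also have "\<dots> = exp (- \<mu>) * (\<Sum>j. \<mu> ^ j / fact j * k j)"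
    unfolding e by (rule suminf_mult[OF summable_norm_cancel[OF s]])
  finally show "(LINT t|poisson_law \<mu>. k t) = exp (- \<mu>) * (\<Sum>j. \<mu> ^ j / fact j * k j)" .
qed

lemma mean_poisson_law:
  assumes "\<mu> \<ge> 0"
  shows "(LINT t|poisson_law \<mu>. real t) = \<mu>"
proof -
  have "(\<Sum>j. real j * (\<mu> ^ j / fact j)) = \<mu> * exp \<mu>"
    using sums_unique[OF sums_nat_times_power_over_fact] by simp
  then show ?thesis
    using integral_poisson_law[of \<mu> real 0 1] assms
    by (simp add: mult.commute exp_minus)
qed

text \<open>Stated for total functions: coordinates outside \<open>{1..i}\<close> do not enter the
  bound, so \<open>g\<close> cannot depend on them, and updates \<open>x(i := t)\<close> need no
  extensionality.\<close>

definition lip :: "nat \<Rightarrow> ((nat \<Rightarrow> nat) \<Rightarrow> real) \<Rightarrow> bool" where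
  "lip i g \<longleftrightarrow> (\<forall>x y. \<bar>g x - g y\<bar> \<le> (\<Sum>j=1..i. \<bar>real (x j) - real (y j)\<bar>))"

definition avg :: "nat \<Rightarrow> real \<Rightarrow> ((nat \<Rightarrow> nat) \<Rightarrow> real) \<Rightarrow> (nat \<Rightarrow> nat) \<Rightarrow> real" where
  "avg i \<mu> g x = (LINT t|poisson_law \<mu>. g (x(i := t)))"

text \<open>Because of the index shift in \<open>stein_sol\<close>, this is the usual Stein solution
  at \<open>x i + 1\<close>, with the other coordinates frozen as parameters.\<close>

definition stein_fun :: "nat \<Rightarrow> real \<Rightarrow> ((nat \<Rightarrow> nat) \<Rightarrow> real) \<Rightarrow> (nat \<Rightarrow> nat) \<Rightarrow> real" where
  "stein_fun i \<mu> g x = stein_sol \<mu> (\<lambda>t. g (x(i := t)) - avg i \<mu> g x) (x i)"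

section \<open>Lipschitz estimates for averages and Stein solutions\<close>

lemma lipD: "lip i g \<Longrightarrow> \<bar>g x - g y\<bar> \<le> (\<Sum>j=1..i. \<bar>real (x j) - real (y j)\<bar>)"
  by (simp add: lip_def)

lemma sum_atLeast1_last:
  fixes f :: "nat \<Rightarrow> real"
  shows "i \<ge> 1 \<Longrightarrow> (\<Sum>j=1..i. f j) = (\<Sum>j\<in>{1..<i}. f j) + f i"
  by (cases i) (simp_all add: atLeastLessThanSuc_atLeastAtMost)

lemma lip_upd:
  assumes "lip i g" "i \<ge> 1"
  shows "\<bar>g (x(i := s)) - g (y(i := t))\<bar>
    \<le> (\<Sum>j\<in>{1..<i}. \<bar>real (x j) - real (y j)\<bar>) + \<bar>real s - real t\<bar>"
  using lipD[OF assms(1), of "x(i := s)" "y(i := t)"]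
  unfolding sum_atLeast1_last[OF assms(2)] by simp

lemma lip_growth:
  assumes "lip i g" "i \<ge> 1"
  shows "\<bar>g (x(i := s)) - c\<bar> \<le> \<bar>g (x(i := 0)) - c\<bar> + 1 * real s"
  using lip_upd[OF assms, of x s x 0] by (simp add: abs_if split: if_splits)

lemma integrable_lip:
  assumes "lip i g" "i \<ge> 1" "\<mu> \<ge> 0"
  shows "integrable (poisson_law \<mu>) (\<lambda>t. g (x(i := t)))"
  using lip_growth[OF assms(1,2), of x _ 0]
  by (intro integrable_poisson_law[where A = "\<bar>g (x(i := 0))\<bar>" and B = 1] assms) simp

text \<open>Both averages use the same Poisson value in coordinate \<open>Suc i\<close>, so this
  coordinate cancels from the Lipschitz bound.\<close>

lemma lip_avg:
  assumes "lip (Suc i) g" "\<mu> \<ge> 0"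
  shows "lip i (avg (Suc i) \<mu> g)"
  unfolding lip_def
proof (intro allI)
  fix x y
  note int = integrable_lip[OF assms(1) _ assms(2), simplified]
  have "\<bar>avg (Suc i) \<mu> g x - avg (Suc i) \<mu> g y\<bar>
      = \<bar>LINT t|poisson_law \<mu>. g (x(Suc i := t)) - g (y(Suc i := t))\<bar>"
    unfolding avg_def by (simp add: Bochner_Integration.integral_diff int)
  also have "\<dots> \<le> (LINT t|poisson_law \<mu>. \<bar>g (x(Suc i := t)) - g (y(Suc i := t))\<bar>)"
    by (rule integral_abs_bound)
  also have "\<dots> \<le> (LINT t|poisson_law \<mu>. (\<Sum>j=1..i. \<bar>real (x j) - real (y j)\<bar>))"
  proof (rule integral_mono)
    show "\<bar>g (x(Suc i := t)) - g (y(Suc i := t))\<bar> \<le> (\<Sum>j=1..i. \<bar>real (x j) - real (y j)\<bar>)" for t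
      using lip_upd[OF assms(1), of x t y t] by (simp add: atLeastLessThanSuc_atLeastAtMost)
  qed (intro integrable_abs Bochner_Integration.integrable_diff int measure_pmf.integrable_const)+
  finally show "\<bar>avg (Suc i) \<mu> g x - avg (Suc i) \<mu> g y\<bar> \<le> (\<Sum>j=1..i. \<bar>real (x j) - real (y j)\<bar>)"
    by simp
qed

text \<open>The solvability condition of the Stein equation.\<close>

lemma lip_centred:
  assumes "lip i g" "i \<ge> 1" "\<mu> \<ge> 0"
  shows "(\<Sum>j. \<mu> ^ j / fact j * (g (x(i := j)) - avg i \<mu> g x)) = 0"
proof -
  have "(LINT t|poisson_law \<mu>. g (x(i := t)) - avg i \<mu> g x) = 0"
    by (simp add: Bochner_Integration.integral_diff integrable_lip[OF assms]
        measure_pmf.integrable_const avg_def measure_pmf.prob_space)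
  then show ?thesis
    using integral_poisson_law[OF assms(3) lip_growth[OF assms(1,2)]] by simp
qed

text \<open>Separating the running argument \<open>t\<close> from the parameters \<open>x\<close>
  allows two parameter vectors to be compared at the same argument.\<close>

lemma
  assumes "lip i g" "i \<ge> 1" "\<mu> \<ge> 0"
  defines "F x \<equiv> stein_sol \<mu> (\<lambda>t. g (x(i := t)) - avg i \<mu> g x)"
  shows stein_lip_eq: "\<mu> * F x t - real t * F x (t - 1) = g (x(i := t)) - avg i \<mu> g x"
    and stein_lip_bdd: "\<exists>C. \<forall>t. \<bar>F x t\<bar> \<le> C"
proof -
  show "\<mu> * F x t - real t * F x (t - 1) = g (x(i := t)) - avg i \<mu> g x"
    unfolding F_def
    by (rule stein_equation[OF assms(3) _ _ lip_growth[OF assms(1,2)] lip_centred[OF assms(1-3)]]) auto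
  show "\<exists>C. \<forall>t. \<bar>F x t\<bar> \<le> C"
    unfolding F_def using stein_sol_bounded[OF assms(3) _ _ lip_growth[OF assms(1,2)]]
    by (meson abs_ge_zero zero_le_one)
qed

text \<open>Lowering coordinate \<open>i\<close> changes neither the parameters nor the centring,
  since both see \<open>x\<close> only through \<open>x(i := t)\<close>. At \<open>x i = 0\<close>
  the truncated \<open>x i - 1\<close> carries the factor zero.\<close>

lemma stein_fun_eq:
  assumes "lip i g" "i \<ge> 1" "\<mu> \<ge> 0"
  shows "\<mu> * stein_fun i \<mu> g x - real (x i) * stein_fun i \<mu> g (x(i := x i - 1))
    = g x - avg i \<mu> g x"
  using stein_lip_eq[OF assms, of x "x i"] by (simp add: stein_fun_def avg_def)

lemma lipschitz_nat_from_steps: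
  fixes F :: "nat \<Rightarrow> real"
  assumes "\<And>t. \<bar>F (Suc t) - F t\<bar> \<le> 1"
  shows "\<bar>F s - F t\<bar> \<le> \<bar>real s - real t\<bar>"
proof -
  have *: "\<bar>F (t + u) - F t\<bar> \<le> real u" for t u
  proof (induction u)
    case (Suc u)
    then show ?case using assms[of "t + u"] by simp
  qed simp
  show ?thesis
    using *[of t "s - t"] *[of s "t - s"] by (cases "t \<le> s") (simp_all add: of_nat_diff abs_minus_commute)
qed

text \<open>First the argument moves from \<open>x i\<close> to \<open>y i\<close> with the
  parameters of \<open>x\<close>, then the parameters move. The second stage costs
  \<open>2 * K\<close> because an increment of the right-hand side involves \<open>g\<close> at two
  arguments, each contributing at most \<open>K\<close>.\<close>

lemma stein_fun_lipschitz:
  assumes "lip i g" "i \<ge> 1" "\<mu> \<ge> 0"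
  shows "\<bar>stein_fun i \<mu> g x - stein_fun i \<mu> g y\<bar>
    \<le> \<bar>real (x i) - real (y i)\<bar> + 2 * (\<Sum>j\<in>{1..<i}. \<bar>real (x j) - real (y j)\<bar>)"
proof -
  define F where "F z = stein_sol \<mu> (\<lambda>t. g (z(i := t)) - avg i \<mu> g z)" for z
  define K where "K = (\<Sum>j\<in>{1..<i}. \<bar>real (x j) - real (y j)\<bar>)"
  note eq = stein_lip_eq[OF assms, folded F_def]
  note bdd = stein_lip_bdd[OF assms, folded F_def]
  obtain Cx Cy where C: "\<And>t. \<bar>F x t\<bar> \<le> Cx" "\<And>t. \<bar>F y t\<bar> \<le> Cy"
    using bdd[of x] bdd[of y] by auto
  have "\<bar>F x (Suc t) - F x t\<bar> \<le> 1" for t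
  proof (rule stein_difference_bound[where F = "F x", OF assms(3) eq C(1)])
    show "\<bar>g (x(i := Suc s)) - avg i \<mu> g x - (g (x(i := s)) - avg i \<mu> g x)\<bar> \<le> 1" for s
      using lip_upd[OF assms(1,2), of x "Suc s" x s] by simp
  qed
  then have 1: "\<bar>F x (x i) - F x (y i)\<bar> \<le> \<bar>real (x i) - real (y i)\<bar>"
    by (rule lipschitz_nat_from_steps)
  have "\<bar>F x t - F y t\<bar> \<le> 2 * K" for t
  proof (rule stein_bound[where F = "\<lambda>t. F x t - F y t" and \<mu> = \<mu>])
    show "\<mu> * (F x s - F y s) - real s * (F x (s - 1) - F y (s - 1))
      = (g (x(i := s)) - avg i \<mu> g x) - (g (y(i := s)) - avg i \<mu> g y)" for s
      using eq[of x s] eq[of y s] by (simp add: algebra_simps)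
    show "\<bar>F x s - F y s\<bar> \<le> Cx + Cy" for s
      using C(1)[of s] C(2)[of s] by linarith
    show "\<bar>g (x(i := Suc s)) - avg i \<mu> g x - (g (y(i := Suc s)) - avg i \<mu> g y)
        - (g (x(i := s)) - avg i \<mu> g x - (g (y(i := s)) - avg i \<mu> g y))\<bar> \<le> 2 * K" for s
      using lip_upd[OF assms(1,2), of x s y s] lip_upd[OF assms(1,2), of x "Suc s" y "Suc s"]
      unfolding K_def[symmetric] by linarith
  qed (fact assms(3))
  from 1 this[of "y i"] show ?thesis
    unfolding stein_fun_def F_def[symmetric] K_def[symmetric] by linarith
qed

section \<open>Products of Poisson laws and the telescoping argument\<close>

lemma nvec_eq_count_space: "nvec d = count_space (PiE {1..d} (\<lambda>_. UNIV))"
  unfolding nvec_def by (rule count_space_PiM_finite) auto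

abbreviation poisson_product :: "nat \<Rightarrow> (nat \<Rightarrow> real) \<Rightarrow> (nat \<Rightarrow> nat) measure" where
  "poisson_product d l \<equiv> (\<Pi>\<^sub>M j\<in>{1..d}. measure_pmf (poisson_law (l j)))"

lemma measurable_poisson_product:
  "g \<in> borel_measurable (poisson_product d l)"
proof -
  have "sets (poisson_product d l) = sets (nvec d)"
    unfolding nvec_def by (rule sets_PiM_cong) auto
  moreover have "g \<in> borel_measurable (nvec d)"
    by (simp add: nvec_eq_count_space)
  ultimately show ?thesis
    using measurable_cong_sets[OF _ refl] by blast
qed

lemma integrable_coordinate_poisson_product:
  assumes "j \<in> {1..d}" "l j \<ge> 0"
  shows "integrable (poisson_product d l) (\<lambda>x. real (x j))"
proof -
  let ?M = "poisson_product d l"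
  have "distr ?M (measure_pmf (poisson_law (l j))) (\<lambda>x. x j) = measure_pmf (poisson_law (l j))"
    by (rule distr_PiM_component) (use assms in \<open>auto intro: measure_pmf.prob_space_axioms\<close>)
  moreover have "integrable (measure_pmf (poisson_law (l j))) real"
    by (rule integrable_poisson_law[where A = 0 and B = 1]) (use assms in auto)
  moreover have "(\<lambda>x. x j) \<in> measurable ?M (measure_pmf (poisson_law (l j)))"
    using assms by (intro measurable_component_singleton)
  ultimately show ?thesis
    by (metis integrable_distr)
qed

lemma integrable_poisson_product:
  assumes "lip d g" "\<And>j. j \<in> {1..d} \<Longrightarrow> l j \<ge> 0"
  shows "integrable (poisson_product d l) g"
proof (rule Bochner_Integration.integrable_bound)
  interpret prob_space "poisson_product d l"
    by (intro prob_space_PiM measure_pmf.prob_space_axioms)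
  show "integrable (poisson_product d l)
      (\<lambda>x. \<bar>g (\<lambda>_. 0)\<bar> + (\<Sum>j=1..d. real (x j)))"
    using assms(2)
    by (intro Bochner_Integration.integrable_add integrable_const Bochner_Integration.integrable_sum
        integrable_coordinate_poisson_product) auto
  show "AE x in poisson_product d l.
      norm (g x) \<le> norm (\<bar>g (\<lambda>_. 0)\<bar> + (\<Sum>j=1..d. real (x j)))"
  proof (rule AE_I2)
    fix x
    have "0 \<le> (\<Sum>j=1..d. real (x j))" by (rule sum_nonneg) simp
    then show "norm (g x) \<le> norm (\<bar>g (\<lambda>_. 0)\<bar> + (\<Sum>j=1..d. real (x j)))"
      using lipD[OF assms(1), of x "\<lambda>_. 0"] by simp
  qed
qed (rule measurable_poisson_product)

text \<open>Fubini, with the last coordinate integrated first.\<close>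

lemma integral_poisson_product_Suc:
  assumes "lip (Suc d) g" "\<And>j. j \<in> {1..Suc d} \<Longrightarrow> l j \<ge> 0"
  shows "(LINT x|poisson_product (Suc d) l. g x)
    = (LINT x|poisson_product d l. avg (Suc d) (l (Suc d)) g x)"
proof -
  interpret product_sigma_finite "\<lambda>j. measure_pmf (poisson_law (l j))"
    by unfold_locales
  have "{1..Suc d} = insert (Suc d) {1..d}" by auto
  then show ?thesis
    using product_integral_insert[of "{1..d}" "Suc d" g] integrable_poisson_product[OF assms]
    by (simp add: avg_def)
qed

text \<open>Averaging out the last coordinate leaves a Lipschitz function of one coordinate fewer,
  to which \<open>step\<close> applies again; the Poisson product integral unwinds in the same
  order.\<close>

lemma lindeberg_telescoping:
  assumes "prob_space M"
    and l: "\<And>j. j \<in> {1..d} \<Longrightarrow> l j \<ge> 0"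
    and step: "\<And>i g. i \<in> {1..d} \<Longrightarrow> lip i g \<Longrightarrow>
      \<bar>(LINT \<omega>|M. g (X \<omega>)) - (LINT \<omega>|M. avg i (l i) g (X \<omega>))\<bar> \<le> b i"
    and "i \<le> d" "lip i g"
  shows "\<bar>(LINT \<omega>|M. g (X \<omega>)) - (LINT x|poisson_product i l. g x)\<bar>
    \<le> (\<Sum>j=1..i. b j)"
  using assms(4,5)
proof (induction i arbitrary: g)
  case 0
  interpret prob_space M by fact
  interpret P: prob_space "\<Pi>\<^sub>M j\<in>{}. measure_pmf (poisson_law (l j))"
    by (rule prob_space_PiM) (rule measure_pmf.prob_space_axioms)
  \<comment> \<open>With no coordinates left the Lipschitz bound is an empty sum, so
    \<open>g\<close> is constant.\<close>
  have "g = (\<lambda>_. g (\<lambda>_. 0))"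
    using lipD[OF 0(2)] by (auto simp: fun_eq_iff)
  then obtain c where "g = (\<lambda>_. c)" ..
  then show ?case by (simp add: prob_space P.prob_space)
next
  case (Suc i)
  let ?g = "avg (Suc i) (l (Suc i)) g"
  have "lip i ?g"
    using Suc.prems l by (intro lip_avg) auto
  then have "\<bar>(LINT \<omega>|M. ?g (X \<omega>)) - (LINT x|poisson_product i l. ?g x)\<bar>
      \<le> (\<Sum>j=1..i. b j)"
    using Suc by auto
  moreover have "\<bar>(LINT \<omega>|M. g (X \<omega>)) - (LINT \<omega>|M. ?g (X \<omega>))\<bar> \<le> b (Suc i)"
    using Suc.prems by (intro step) auto
  moreover have "(LINT x|poisson_product (Suc i) l. g x)
    = (LINT x|poisson_product i l. ?g x)"
    using Suc.prems l by (intro integral_poisson_product_Suc) auto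
  ultimately show ?case by simp
qed

text \<open>The rates hidden in \<open>poisson_vector\<close> are identified by the means, since
  \<open>poisson_law\<close> has its rate as mean; independence then makes the law the product
  law.\<close>

lemma integral_poisson_vector:
  fixes g :: "(nat \<Rightarrow> nat) \<Rightarrow> real"
  assumes N: "prob_space N" and P: "poisson_vector N d P" and "d \<ge> 1"
    and mean: "\<And>j. j \<in> {1..d} \<Longrightarrow> (LINT \<omega>|N. real (P \<omega> j)) = l j"
  shows "(LINT \<omega>|N. g (P \<omega>)) = (LINT x|poisson_product d l. g x)"
proof -
  interpret prob_space N by fact
  have meas: "P \<in> measurable N (nvec d)" using P by (simp add: poisson_vector_def)
  have comp: "(\<lambda>\<omega>. P \<omega> j) \<in> measurable N (count_space UNIV)" if "j \<in> {1..d}" for j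
    using measurable_compose[OF meas[unfolded nvec_def] measurable_component_singleton[OF that]] .
  have law: "distr N (count_space UNIV) (\<lambda>\<omega>. P \<omega> j) = measure_pmf (poisson_law (l j))"
    if j: "j \<in> {1..d}" for j
  proof -
    obtain \<mu> where \<mu>: "\<mu> \<ge> 0" "distr N (count_space UNIV) (\<lambda>\<omega>. P \<omega> j) = measure_pmf (poisson_law \<mu>)"
      using P j unfolding poisson_vector_def by blast
    have "(LINT \<omega>|N. real (P \<omega> j)) = (LINT t|distr N (count_space UNIV) (\<lambda>\<omega>. P \<omega> j). real t)"
      by (rule integral_distr[symmetric]) (use comp j in auto)
    then have "\<mu> = l j" using \<mu> mean[OF j] mean_poisson_law by simp
    with \<mu> show ?thesis by simp
  qed
  have "distr N (nvec d) P = distr N (nvec d) (\<lambda>\<omega>. \<lambda>j\<in>{1..d}. P \<omega> j)"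
  proof (rule distr_cong)
    fix \<omega> assume "\<omega> \<in> space N"
    then have "P \<omega> \<in> PiE {1..d} (\<lambda>_. UNIV)"
      using measurable_space[OF meas] by (simp add: nvec_eq_count_space)
    then show "P \<omega> = (\<lambda>j\<in>{1..d}. P \<omega> j)" by (simp add: PiE_restrict)
  qed auto
  also have "\<dots> = (\<Pi>\<^sub>M j\<in>{1..d}. distr N (count_space UNIV) (\<lambda>\<omega>. P \<omega> j))"
    unfolding nvec_def
    using indep_vars_iff_distr_eq_PiM'[of "{1..d}" "\<lambda>j \<omega>. P \<omega> j" "\<lambda>_. count_space UNIV"] comp P \<open>d \<ge> 1\<close>
    by (simp add: poisson_vector_def)
  also have "\<dots> = (poisson_product d l)"
    by (rule PiM_cong) (simp_all add: law)
  finally have D: "distr N (nvec d) P = (poisson_product d l)" .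
  have "(LINT \<omega>|N. g (P \<omega>)) = (LINT x|distr N (nvec d) P. g x)"
    by (subst integral_distr[OF meas]) (simp_all add: nvec_eq_count_space)
  then show ?thesis by (simp only: D)
qed

section \<open>Locally dependent Bernoulli vectors\<close>

text \<open>Finiteness of the set makes \<open>Max\<close> an upper bound. Nonnegativity is
  inherited from any member, and \<open>d \<ge> 1\<close> provides one as soon as \<open>R\<close>
  is nonempty.\<close>

lemma
  assumes "d \<ge> 1"
  shows Qmax_nonneg: "0 \<le> Qmax M d n m Y k"
    and Qmax_ge: "r \<in> nbhd n m k - {k} \<Longrightarrow> i \<in> {1..d} \<Longrightarrow> j \<in> {1..d} \<Longrightarrow>
      (LINT \<omega>|M. indicator {basis_vec d i} (Y k \<omega>) * indicator {basis_vec d j} (Y r \<omega>)) \<le> Qmax M d n m Y k"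
proof -
  define R where "R = {r\<in>{1..n}. 1 \<le> \<bar>int k - int r\<bar> \<and> \<bar>int k - int r\<bar> \<le> int m}"
  define f where "f = (\<lambda>r i j. LINT \<omega>|M. indicator {basis_vec d i} (Y k \<omega>) * indicator {basis_vec d j} (Y r \<omega>) :: real)"
  define S where "S = {f r i j | r i j. r \<in> R \<and> i \<in> {1..d} \<and> j \<in> {1..d}}"
  have Q: "Qmax M d n m Y k = (if R = {} then 0 else Max S)"
    unfolding Qmax_def R_def f_def S_def Let_def ..
  have "S = (\<Union>r\<in>R. \<Union>i\<in>{1..d}. f r i ` {1..d})"
    unfolding S_def by blast
  moreover have "finite R" unfolding R_def by simp
  ultimately have fin: "finite S" by simp
  have pos: "f r i j \<ge> 0" for r i j
    unfolding f_def by (rule integral_nonneg_AE) simp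
  show "r \<in> nbhd n m k - {k} \<Longrightarrow> i \<in> {1..d} \<Longrightarrow> j \<in> {1..d} \<Longrightarrow>
      (LINT \<omega>|M. indicator {basis_vec d i} (Y k \<omega>) * indicator {basis_vec d j} (Y r \<omega>)) \<le> Qmax M d n m Y k"
  proof -
    assume a: "r \<in> nbhd n m k - {k}" "i \<in> {1..d}" "j \<in> {1..d}"
    then have "r \<in> R" unfolding R_def nbhd_def by auto
    then have "f r i j \<in> S" using a unfolding S_def by blast
    then have "f r i j \<le> Max S" using fin by simp
    then show ?thesis using \<open>r \<in> R\<close> by (auto simp: Q f_def)
  qed
  show "0 \<le> Qmax M d n m Y k"
  proof (cases "R = {}")
    case False
    then obtain r where "r \<in> R" by auto
    then have "f r 1 1 \<in> S" using assms unfolding S_def by force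
    then have "f r 1 1 \<le> Max S" using fin by simp
    then show ?thesis using pos[of r 1 1] False by (simp add: Q)
  qed (simp add: Q)
qed


text \<open>At most \<open>m\<close> indices lie on each side; truncation of \<open>k - m\<close>
  only shortens the left interval.\<close>

lemma card_nbhd_minus: "card (nbhd n m k - {k}) \<le> 2 * m"
proof -
  have "nbhd n m k - {k} \<subseteq> {k - m..<k} \<union> {k<..k + m}"
    unfolding nbhd_def by auto
  then have "card (nbhd n m k - {k}) \<le> card ({k - m..<k} \<union> {k<..k + m})"
    by (rule card_mono[rotated]) simp
  also have "\<dots> \<le> card {k - m..<k} + card {k<..k + m}" by (rule card_Un_le)
  also have "\<dots> \<le> 2 * m" by simp
  finally show ?thesis .
qed

section \<open>Values of Bernoulli vectors\<close>

lemma basis_vec_eq_iff: "i \<in> {1..d} \<Longrightarrow> basis_vec d i = basis_vec d j \<longleftrightarrow> i = j"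
  unfolding basis_vec_def by (auto simp: fun_eq_iff restrict_def split: if_splits)

lemma basis_vec_neq_zero_vec: "i \<in> {1..d} \<Longrightarrow> basis_vec d i \<noteq> zero_vec d"
  unfolding basis_vec_def zero_vec_def by (auto simp: fun_eq_iff restrict_def split: if_splits)

text \<open>A finite set that carries each \<open>Y r\<close> almost surely, so that expectations
  become finite sums.\<close>

definition bernoulli_values :: "nat \<Rightarrow> (nat \<Rightarrow> nat) set" where
  "bernoulli_values d = insert (zero_vec d) (basis_vec d ` {1..d})"

lemma finite_bernoulli_values: "finite (bernoulli_values d)"
  by (simp add: bernoulli_values_def)

text \<open>Passes from the coordinates, which add up to \<open>X\<close>, to the indicators, whose
  expectations and products enter the bound.\<close>

lemma bernoulli_values_component:
  assumes "v \<in> bernoulli_values d" "j \<in> {1..d}"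
  shows "real (v j) = indicator {basis_vec d j} v"
proof -
  consider "v = zero_vec d" | i where "i \<in> {1..d}" "v = basis_vec d i"
    using assms(1) unfolding bernoulli_values_def by blast
  then show ?thesis
  proof cases
    case 1
    then show ?thesis using assms(2) basis_vec_neq_zero_vec[OF assms(2)]
      by (auto simp: zero_vec_def indicator_def)
  next
    case 2
    then have "v j = (if j = i then 1 else 0)" using assms(2) by (simp add: basis_vec_def)
    moreover have "v = basis_vec d j \<longleftrightarrow> i = j" using 2 by (simp add: basis_vec_eq_iff)
    ultimately show ?thesis by (simp add: indicator_def)
  qed
qed

text \<open>Not restricted to \<open>{1..d}\<close>, in contrast to \<open>sum_vec\<close>, because
  \<open>lip\<close> works with total functions.\<close>

definition vsum :: "('r \<Rightarrow> 'a \<Rightarrow> nat \<Rightarrow> nat) \<Rightarrow> 'r set \<Rightarrow> 'a \<Rightarrow> nat \<Rightarrow> nat" where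
  "vsum Y D \<omega> = (\<lambda>j. \<Sum>r\<in>D. Y r \<omega> j)"

locale bernoulli_vectors = prob_space M for M :: "'a measure" +
  fixes n d m :: nat and Y :: "nat \<Rightarrow> 'a \<Rightarrow> nat \<Rightarrow> nat" and p :: "nat \<Rightarrow> nat \<Rightarrow> real"
  assumes d_pos: "d \<ge> 1"
    and Y_measurable: "r \<in> {1..n} \<Longrightarrow> Y r \<in> measurable M (nvec d)"
    and dependence: "m_dependent M (nvec d) m n Y"
    and prob_basis: "r \<in> {1..n} \<Longrightarrow> j \<in> {1..d} \<Longrightarrow> prob {\<omega> \<in> space M. Y r \<omega> = basis_vec d j} = p r j"
    and prob_zero: "r \<in> {1..n} \<Longrightarrow> prob {\<omega> \<in> space M. Y r \<omega> = zero_vec d} = 1 - (\<Sum>j=1..d. p r j)"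
begin

lemma event_value: "r \<in> {1..n} \<Longrightarrow> {\<omega> \<in> space M. Y r \<omega> = v} \<in> events"
proof -
  assume r: "r \<in> {1..n}"
  have "{v} \<inter> space (nvec d) \<in> sets (nvec d)" by (simp add: nvec_eq_count_space)
  from measurable_sets[OF Y_measurable[OF r] this]
  have "Y r -` ({v} \<inter> space (nvec d)) \<inter> space M \<in> events" .
  moreover have "Y r -` ({v} \<inter> space (nvec d)) \<inter> space M = {\<omega> \<in> space M. Y r \<omega> = v}"
    using measurable_space[OF Y_measurable[OF r]] by auto
  ultimately show ?thesis by simp
qed

lemma p_nonneg: "r \<in> {1..n} \<Longrightarrow> j \<in> {1..d} \<Longrightarrow> p r j \<ge> 0"
  using prob_basis[of r j] measure_nonneg by metis

text \<open>The prescribed probabilities of the distinct values add up to one.\<close>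

lemma AE_bernoulli: "AE \<omega> in M. \<forall>r\<in>{1..n}. Y r \<omega> \<in> bernoulli_values d"
proof (rule AE_finite_allI)
  fix r assume r: "r \<in> {1..n}"
  define A where "A v = {\<omega> \<in> space M. Y r \<omega> = v}" for v
  have "prob (\<Union>v\<in>bernoulli_values d. A v) = (\<Sum>v\<in>bernoulli_values d. prob (A v))"
    using r by (intro finite_measure_finite_Union)
      (auto simp: A_def finite_bernoulli_values disjoint_family_on_def event_value)
  also have "\<dots> = prob (A (zero_vec d)) + (\<Sum>v\<in>basis_vec d ` {1..d}. prob (A v))"
    unfolding bernoulli_values_def by (subst sum.insert) (use basis_vec_neq_zero_vec in force)+
  also have "(\<Sum>v\<in>basis_vec d ` {1..d}. prob (A v)) = (\<Sum>j=1..d. prob (A (basis_vec d j)))"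
    by (subst sum.reindex) (auto simp: inj_on_def basis_vec_eq_iff)
  also have "\<dots> = (\<Sum>j=1..d. p r j)"
    using r prob_basis by (intro sum.cong) (auto simp: A_def)
  finally have "prob (\<Union>v\<in>bernoulli_values d. A v) = 1"
    using prob_zero[OF r] by (simp add: A_def)
  moreover have "(\<Union>v\<in>bernoulli_values d. A v) \<in> events"
    using r by (intro sets.finite_UN) (auto simp: A_def finite_bernoulli_values event_value)
  ultimately have "AE \<omega> in M. \<omega> \<in> (\<Union>v\<in>bernoulli_values d. A v)"
    using AE_in_set_eq_1 by blast
  then show "AE \<omega> in M. Y r \<omega> \<in> bernoulli_values d"
    by (rule AE_mp) (simp add: A_def)
qed simp

section \<open>Joint laws of blocks of vectors\<close>

definition agree :: "nat set \<Rightarrow> (nat \<Rightarrow> nat \<Rightarrow> nat) \<Rightarrow> 'a set" where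
  "agree S c = {\<omega> \<in> space M. \<forall>s\<in>S. Y s \<omega> = c s}"

lemma agree_event: "S \<subseteq> {1..n} \<Longrightarrow> agree S c \<in> events"
proof -
  assume S: "S \<subseteq> {1..n}"
  then have "finite S" by (rule finite_subset) simp
  then show ?thesis
    unfolding agree_def using S event_value by (intro sets.sets_Collect_finite_All) auto
qed

lemma PiM_nvec_count_space:
  "finite S \<Longrightarrow> (\<Pi>\<^sub>M s\<in>S. nvec d) = count_space (PiE S (\<lambda>_. PiE {1..d} (\<lambda>_. UNIV)))"
  unfolding nvec_eq_count_space by (rule count_space_PiM_finite) (auto intro: countable_PiE)

lemma prob_agree_Un:
  assumes S: "S \<subseteq> {1..n}" and T: "T \<subseteq> {1..n}" and far: "\<And>s t. s \<in> S \<Longrightarrow> t \<in> T \<Longrightarrow> t + m < s"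
  shows "prob (agree (S \<union> T) c) = prob (agree S c) * prob (agree T c)"
\<comment> \<open>\<open>m_dependent\<close> speaks of nonempty blocks; an empty block gives the
  event \<open>space M\<close> of probability one.\<close>
proof (cases "S = {} \<or> T = {}")
  case True
  then show ?thesis by (auto simp: agree_def prob_space)
next
  case False
  have fin: "finite S" "finite T" using S T finite_subset by blast+
  define A where "A U = {x \<in> space (\<Pi>\<^sub>M s\<in>U. nvec d). \<forall>s\<in>U. x s = c s}" for U
  have A: "A U \<in> sets (\<Pi>\<^sub>M s\<in>U. nvec d)" if "finite U" for U
    using that unfolding A_def by (simp add: PiM_nvec_count_space)
  have vimage: "(\<lambda>\<omega>. \<lambda>s\<in>U. Y s \<omega>) -` A U \<inter> space M = agree U c" if "U \<subseteq> {1..n}" for U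
  proof -
    have "(\<lambda>s\<in>U. Y s \<omega>) \<in> space (\<Pi>\<^sub>M s\<in>U. nvec d)" if "\<omega> \<in> space M" for \<omega>
      using that \<open>U \<subseteq> {1..n}\<close> measurable_space[OF Y_measurable] by (auto simp: space_PiM)
    then show ?thesis unfolding A_def agree_def by auto
  qed
  have "Min S \<in> S" "Max T \<in> T" using fin False by auto
  then have "int (Min S) - int (Max T) > int m" using far by force
  then have "indep_var (\<Pi>\<^sub>M s\<in>S. nvec d) (\<lambda>\<omega>. \<lambda>s\<in>S. Y s \<omega>) (\<Pi>\<^sub>M t\<in>T. nvec d) (\<lambda>\<omega>. \<lambda>t\<in>T. Y t \<omega>)"
    using dependence S T False unfolding m_dependent_def by blast
  from indep_varD[OF this A A] fin
  have "prob ((\<lambda>\<omega>. (\<lambda>s\<in>S. Y s \<omega>, \<lambda>t\<in>T. Y t \<omega>)) -` (A S \<times> A T) \<inter> space M)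
    = prob ((\<lambda>\<omega>. \<lambda>s\<in>S. Y s \<omega>) -` A S \<inter> space M) * prob ((\<lambda>\<omega>. \<lambda>t\<in>T. Y t \<omega>) -` A T \<inter> space M)"
    by simp
  moreover have "(\<lambda>\<omega>. (\<lambda>s\<in>S. Y s \<omega>, \<lambda>t\<in>T. Y t \<omega>)) -` (A S \<times> A T) \<inter> space M
    = ((\<lambda>\<omega>. \<lambda>s\<in>S. Y s \<omega>) -` A S \<inter> space M) \<inter> ((\<lambda>\<omega>. \<lambda>t\<in>T. Y t \<omega>) -` A T \<inter> space M)"
    by auto
  moreover have "agree S c \<inter> agree T c = agree (S \<union> T) c"
    unfolding agree_def by auto
  ultimately show ?thesis using vimage[OF S] vimage[OF T] by simp
qed

text \<open>\<^const>\<open>m_dependent\<close> only separates a left block from a right block, whereas here the indices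
  far from \<open>k\<close> lie on both sides. The left block is first split off from \<open>k\<close> together with the
  right block.\<close>

lemma prob_agree_far:
  assumes k: "k \<in> {1..n}"
  defines "D \<equiv> {1..n} - nbhd n m k"
  shows "prob (agree (insert k D) c) = prob (agree {k} c) * prob (agree D c)"
proof -
  define L where "L = {r \<in> D. r < k}"
  define R where "R = {r \<in> D. k < r}"
  have D: "D = R \<union> L" unfolding L_def R_def D_def nbhd_def using k by auto
  have sub: "L \<subseteq> {1..n}" "R \<subseteq> {1..n}" unfolding L_def R_def D_def by auto
  have far: "t + m < k" if "t \<in> L" for t using that unfolding L_def D_def nbhd_def by auto
  have far': "k + m < s" if "s \<in> R" for s using that unfolding R_def D_def nbhd_def by auto
  have "insert k D = (R \<union> {k}) \<union> L" using D by auto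
  then have "prob (agree (insert k D) c) = prob (agree (R \<union> {k}) c) * prob (agree L c)"
    using prob_agree_Un[of "R \<union> {k}" L c] k sub far far' by force
  also have "prob (agree (R \<union> {k}) c) = prob (agree R c) * prob (agree {k} c)"
    using prob_agree_Un[of R "{k}" c] k sub far' by force
  \<comment> \<open>The factorisation for \<open>R\<close> and \<open>L\<close>, read from right to
    left, restores \<open>D\<close>.\<close>
  finally show ?thesis
    using prob_agree_Un[of R L c] D sub far far' by force
qed

lemma family_measurable:
  fixes h :: "(nat \<Rightarrow> nat \<Rightarrow> nat) \<Rightarrow> real"
  assumes "D \<subseteq> {1..n}"
  shows "(\<lambda>\<omega>. h (\<lambda>r\<in>D. Y r \<omega>)) \<in> borel_measurable M"
proof -
  have "finite D" using assms finite_subset by blast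
  moreover have "(\<lambda>\<omega>. \<lambda>r\<in>D. Y r \<omega>) \<in> measurable M (\<Pi>\<^sub>M r\<in>D. nvec d)"
    using assms Y_measurable by (intro measurable_restrict) auto
  ultimately show ?thesis
    by (intro measurable_compose[where g = h, of _ M "\<Pi>\<^sub>M r\<in>D. nvec d"]) (simp_all add: PiM_nvec_count_space)
qed

lemma AE_family:
  assumes "D \<subseteq> {1..n}"
  shows "AE \<omega> in M. (\<lambda>r\<in>D. Y r \<omega>) \<in> PiE D (\<lambda>_. bernoulli_values d)"
  using AE_bernoulli by (rule AE_mp) (use assms in auto)

text \<open>Almost surely the family takes finitely many values, so \<open>h\<close> is bounded
  there by the sum of its absolute values.\<close>

lemma integrable_family:
  fixes h :: "(nat \<Rightarrow> nat \<Rightarrow> nat) \<Rightarrow> real"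
  assumes "D \<subseteq> {1..n}"
  shows "integrable M (\<lambda>\<omega>. h (\<lambda>r\<in>D. Y r \<omega>))"
proof (rule integrable_const_bound)
  let ?S = "PiE D (\<lambda>_. bernoulli_values d)"
  have "finite D" using assms finite_subset by blast
  then have fin: "finite ?S" by (simp add: finite_PiE finite_bernoulli_values)
  show "AE \<omega> in M. norm (h (\<lambda>r\<in>D. Y r \<omega>)) \<le> (\<Sum>c\<in>?S. norm (h c))"
    using AE_family[OF assms] by (rule AE_mp) (auto intro!: AE_I2 member_le_sum simp: fin)
qed (rule family_measurable[OF assms])

text \<open>Such a \<open>Z\<close> factors through the family of all \<open>Y r\<close>, whose
  value space is discrete, so measurability comes for free.\<close>

lemma integrable_if_determined:
  fixes Z :: "'a \<Rightarrow> real"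
  assumes "\<And>\<omega> \<omega>'. \<omega> \<in> space M \<Longrightarrow> \<omega>' \<in> space M \<Longrightarrow> (\<And>r. r \<in> {1..n} \<Longrightarrow> Y r \<omega> = Y r \<omega>') \<Longrightarrow> Z \<omega> = Z \<omega>'"
  shows "integrable M Z"
proof -
  \<comment> \<open>\<open>SOME\<close> picks an outcome with the prescribed values; by hypothesis
    \<open>Z\<close> does not depend on the pick.\<close>
  define h where "h c = Z (SOME \<omega>. \<omega> \<in> space M \<and> (\<forall>r\<in>{1..n}. Y r \<omega> = c r))" for c
  have "h (\<lambda>r\<in>{1..n}. Y r \<omega>) = Z \<omega>" if "\<omega> \<in> space M" for \<omega>
  proof -
    define \<omega>' where "\<omega>' = (SOME \<omega>'. \<omega>' \<in> space M \<and> (\<forall>r\<in>{1..n}. Y r \<omega>' = (\<lambda>r\<in>{1..n}. Y r \<omega>) r))"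
    have "\<omega>' \<in> space M \<and> (\<forall>r\<in>{1..n}. Y r \<omega>' = (\<lambda>r\<in>{1..n}. Y r \<omega>) r)"
      unfolding \<omega>'_def by (rule someI[where x = \<omega>]) (use that in simp)
    then have "Z \<omega>' = Z \<omega>" using that by (intro assms) auto
    then show ?thesis unfolding h_def \<omega>'_def .
  qed
  then have "integrable M Z \<longleftrightarrow> integrable M (\<lambda>\<omega>. h (\<lambda>r\<in>{1..n}. Y r \<omega>))"
    by (intro Bochner_Integration.integrable_cong) auto
  then show ?thesis using integrable_family[of "{1..n}" h] by simp
qed

text \<open>Almost surely exactly one \<open>c\<close> in the sum equals the family. The event
  \<open>A\<close> is carried along so that the factorisation of probabilities applies to each
  summand.\<close>

lemma expectation_family_indicator:
  fixes h :: "(nat \<Rightarrow> nat \<Rightarrow> nat) \<Rightarrow> real"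
  assumes D: "D \<subseteq> {1..n}" and A: "A \<in> events"
  shows "expectation (\<lambda>\<omega>. indicator A \<omega> * h (\<lambda>r\<in>D. Y r \<omega>))
    = (\<Sum>c\<in>PiE D (\<lambda>_. bernoulli_values d). h c * prob (A \<inter> agree D c))"
proof -
  let ?S = "PiE D (\<lambda>_. bernoulli_values d)"
  have "finite D" using D finite_subset by blast
  then have fin: "finite ?S" by (simp add: finite_PiE finite_bernoulli_values)
  have ev: "A \<inter> agree D c \<in> events" for c using A agree_event[OF D] by blast
  have "expectation (\<lambda>\<omega>. indicator A \<omega> * h (\<lambda>r\<in>D. Y r \<omega>))
    = expectation (\<lambda>\<omega>. \<Sum>c\<in>?S. h c * indicator (A \<inter> agree D c) \<omega>)"
  proof (rule integral_cong_AE)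
    show "(\<lambda>\<omega>. indicator A \<omega> * h (\<lambda>r\<in>D. Y r \<omega>)) \<in> borel_measurable M"
      using A by (intro borel_measurable_times family_measurable[OF D]) auto
    show "(\<lambda>\<omega>. \<Sum>c\<in>?S. h c * indicator (A \<inter> agree D c) \<omega>) \<in> borel_measurable M"
      using ev by (intro borel_measurable_sum borel_measurable_times) auto
    show "AE \<omega> in M. indicator A \<omega> * h (\<lambda>r\<in>D. Y r \<omega>) = (\<Sum>c\<in>?S. h c * indicator (A \<inter> agree D c) \<omega>)"
      using AE_family[OF D] AE_space
    proof eventually_elim
      fix \<omega> assume f: "(\<lambda>r\<in>D. Y r \<omega>) \<in> ?S" and \<omega>: "\<omega> \<in> space M"
      have "h c * indicator (A \<inter> agree D c) \<omega>
        = (if c = (\<lambda>r\<in>D. Y r \<omega>) then indicator A \<omega> * h c else 0)" if c: "c \<in> ?S" for c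
      proof -
        have "\<omega> \<in> agree D c \<longleftrightarrow> c = (\<lambda>r\<in>D. Y r \<omega>)"
          using \<omega> c unfolding agree_def by (auto simp: fun_eq_iff restrict_def PiE_iff extensional_def)
        then show ?thesis by (simp add: indicator_def)
      qed
      then have "(\<Sum>c\<in>?S. h c * indicator (A \<inter> agree D c) \<omega>)
        = (\<Sum>c\<in>?S. if c = (\<lambda>r\<in>D. Y r \<omega>) then indicator A \<omega> * h c else 0)"
        by (rule sum.cong[OF refl])
      also have "\<dots> = indicator A \<omega> * h (\<lambda>r\<in>D. Y r \<omega>)"
        using f fin by (simp only: sum.delta if_True)
      finally show "indicator A \<omega> * h (\<lambda>r\<in>D. Y r \<omega>) = (\<Sum>c\<in>?S. h c * indicator (A \<inter> agree D c) \<omega>)" ..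
    qed
  qed
  also have "\<dots> = (\<Sum>c\<in>?S. expectation (\<lambda>\<omega>. h c * indicator (A \<inter> agree D c) \<omega>))"
    using ev by (intro Bochner_Integration.integral_sum integrable_mult_right) 
      (auto intro!: integrable_real_indicator simp: less_top[symmetric])
  also have "\<dots> = (\<Sum>c\<in>?S. h c * prob (A \<inter> agree D c))"
    using ev by (simp add: sets.sets_into_space Int_absorb2)
  finally show ?thesis .
qed

text \<open>Expanding both sides over the values of the far vectors reduces the claim to
  \<open>prob_agree_far\<close> for each value.\<close>

lemma expectation_indep_far:
  assumes k: "k \<in> {1..n}" and i: "i \<in> {1..d}"
  defines "D \<equiv> {1..n} - nbhd n m k"
  shows "expectation (\<lambda>\<omega>. indicator {basis_vec d i} (Y k \<omega>) * \<phi> (vsum Y D \<omega>))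
    = p k i * expectation (\<lambda>\<omega>. \<phi> (vsum Y D \<omega>))"
proof -
  define h where "h c = \<phi> (\<lambda>j. \<Sum>r\<in>D. c r j)" for c :: "nat \<Rightarrow> nat \<Rightarrow> nat"
  have h: "h (\<lambda>r\<in>D. Y r \<omega>) = \<phi> (vsum Y D \<omega>)" for \<omega>
    unfolding h_def vsum_def by simp
  have D: "D \<subseteq> {1..n}" and kD: "k \<notin> D" using k by (auto simp: D_def nbhd_def)
  define A where "A = {\<omega> \<in> space M. Y k \<omega> = basis_vec d i}"
  have A: "A \<in> events" unfolding A_def by (rule event_value[OF k])
  have "prob (A \<inter> agree D c) = p k i * prob (space M \<inter> agree D c)" for c
  proof -
    \<comment> \<open>The update encodes the event for \<open>k\<close>; since \<open>k\<close> is
      not in \<open>D\<close>, the conditions on \<open>D\<close> stay the same.\<close>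
    let ?c = "c(k := basis_vec d i)"
    have "A \<inter> agree D c = agree (insert k D) ?c" "A = agree {k} ?c" "agree D ?c = space M \<inter> agree D c"
      using kD unfolding A_def agree_def by auto
    then show ?thesis
      using prob_agree_far[OF k, of ?c] prob_basis[OF k i] unfolding D_def[symmetric] A_def by simp
  qed
  then have "expectation (\<lambda>\<omega>. indicator A \<omega> * h (\<lambda>r\<in>D. Y r \<omega>))
      = p k i * expectation (\<lambda>\<omega>. indicator (space M) \<omega> * h (\<lambda>r\<in>D. Y r \<omega>))"
    unfolding expectation_family_indicator[OF D A] expectation_family_indicator[OF D sets.top]
    by (simp add: sum_distrib_left mult.left_commute)
  moreover have "expectation (\<lambda>\<omega>. indicator A \<omega> * h (\<lambda>r\<in>D. Y r \<omega>))
      = expectation (\<lambda>\<omega>. indicator {basis_vec d i} (Y k \<omega>) * \<phi> (vsum Y D \<omega>))"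
    by (rule Bochner_Integration.integral_cong) (simp_all add: h A_def indicator_def)
  moreover have "expectation (\<lambda>\<omega>. indicator (space M) \<omega> * h (\<lambda>r\<in>D. Y r \<omega>))
      = expectation (\<lambda>\<omega>. \<phi> (vsum Y D \<omega>))"
    by (rule Bochner_Integration.integral_cong) (simp_all add: h)
  ultimately show ?thesis by simp
qed

section \<open>Remainder estimate for one coordinate\<close>

abbreviation ind :: "nat \<Rightarrow> nat \<Rightarrow> 'a \<Rightarrow> real" where
  "ind r j \<omega> \<equiv> indicator {basis_vec d j} (Y r \<omega>)"

lemma expectation_ind: "r \<in> {1..n} \<Longrightarrow> j \<in> {1..d} \<Longrightarrow> expectation (ind r j) = p r j"
proof -
  assume r: "r \<in> {1..n}" and j: "j \<in> {1..d}"
  have "expectation (ind r j) = expectation (indicator {\<omega> \<in> space M. Y r \<omega> = basis_vec d j})"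
    by (rule Bochner_Integration.integral_cong) (auto simp: indicator_def)
  also have "\<dots> = prob {\<omega> \<in> space M. Y r \<omega> = basis_vec d j}"
    by (simp add: Int_def conj_commute conj_left_commute)
  finally show ?thesis using prob_basis[OF r j] by simp
qed

text \<open>Bounds the effect on the Stein solution of removing \<open>Y r\<close>; 1 and 2 are the
  constants of \<open>stein_fun_lipschitz\<close>.\<close>

definition weight :: "nat \<Rightarrow> nat \<Rightarrow> 'a \<Rightarrow> real" where
  "weight i r \<omega> = ind r i \<omega> + 2 * (\<Sum>j\<in>{1..<i}. ind r j \<omega>)"

text \<open>The first part is the cost of passing from \<open>X\<close> to \<open>W k\<close>. The
  second is the cost from \<open>X\<close> lowered in coordinate \<open>i\<close>; on the event
  \<open>Y k = e_i\<close> this lowering already removes \<open>Y k\<close>, hence \<open>k\<close>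
  is left out.\<close>

definition remainder :: "nat \<Rightarrow> 'a \<Rightarrow> real" where
  "remainder i \<omega> = (\<Sum>k=1..n. p k i * (\<Sum>r\<in>nbhd n m k. weight i r \<omega>)
      + ind k i \<omega> * (\<Sum>r\<in>nbhd n m k - {k}. weight i r \<omega>))"

text \<open>\<open>2 * i - 1\<close> is the total weight \<open>1 + 2 * (i - 1)\<close>, and
  \<open>2 * m\<close> bounds the number of neighbours other than \<open>k\<close>.\<close>

definition coordinate_bound :: "nat \<Rightarrow> real" where
  "coordinate_bound i = (\<Sum>k=1..n. p k i * (\<Sum>r\<in>nbhd n m k. p r i + 2 * (\<Sum>j\<in>{1..<i}. p r j))
      + 2 * real m * (2 * real i - 1) * Qmax M d n m Y k)"

lemma nbhd_subset: "nbhd n m k \<subseteq> {1..n}"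
  by (auto simp: nbhd_def)

lemma integrable_remainder: "integrable M (remainder i)"
  by (rule integrable_if_determined) (auto simp: remainder_def weight_def nbhd_def
      intro!: sum.cong arg_cong2[where f = "(+)"] arg_cong2[where f = "(*)"])

lemma expectation_add_double_sum:
  fixes f :: "'a \<Rightarrow> real" and h :: "nat \<Rightarrow> 'a \<Rightarrow> real"
  assumes "integrable M f" "\<And>j. integrable M (h j)"
  shows "expectation (\<lambda>\<omega>. f \<omega> + 2 * (\<Sum>j\<in>B. h j \<omega>))
    = expectation f + 2 * (\<Sum>j\<in>B. expectation (h j))"
  using assms by (simp add: Bochner_Integration.integral_add Bochner_Integration.integral_sum)

text \<open>The first part is evaluated exactly; in the second every product of two indicators has
  expectation at most \<open>Qmax\<close>, which is available because \<open>k\<close> is excluded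
  from its neighbourhood.\<close>

lemma expectation_remainder:
  assumes i: "i \<in> {1..d}"
  shows "expectation (remainder i) \<le> coordinate_bound i"
proof -
  have int: "integrable M (ind r j)" if "r \<in> {1..n}" for r j
    by (rule integrable_if_determined) (use that in simp)
  have int2: "integrable M (\<lambda>\<omega>. ind k i' \<omega> * ind r j \<omega>)" if "r \<in> {1..n}" "k \<in> {1..n}" for k i' r j
    by (rule integrable_if_determined) (use that in simp)
  have intw: "integrable M (weight i r)" if "r \<in> {1..n}" for r
    by (rule integrable_if_determined) (use that in \<open>simp add: weight_def\<close>)
  have intkw: "integrable M (\<lambda>\<omega>. ind k i \<omega> * weight i r \<omega>)" if "r \<in> {1..n}" "k \<in> {1..n}" for k r
    by (rule integrable_if_determined) (use that in \<open>simp add: weight_def\<close>)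
  have w: "expectation (weight i r) = p r i + 2 * (\<Sum>j\<in>{1..<i}. p r j)" if r: "r \<in> {1..n}" for r
  proof -
    have "expectation (weight i r) = expectation (ind r i) + 2 * (\<Sum>j\<in>{1..<i}. expectation (ind r j))"
      unfolding weight_def by (rule expectation_add_double_sum) (rule int[OF r])+
    then show ?thesis using i r by (simp add: expectation_ind)
  qed
  have kw: "expectation (\<lambda>\<omega>. ind k i \<omega> * weight i r \<omega>) \<le> (2 * real i - 1) * Qmax M d n m Y k"
    if k: "k \<in> {1..n}" and r: "r \<in> nbhd n m k - {k}" for k r
  proof -
    have r': "r \<in> {1..n}" using r nbhd_subset by blast
    have "expectation (\<lambda>\<omega>. ind k i \<omega> * weight i r \<omega>)
      = expectation (\<lambda>\<omega>. ind k i \<omega> * ind r i \<omega> + 2 * (\<Sum>j\<in>{1..<i}. ind k i \<omega> * ind r j \<omega>))"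
      unfolding weight_def distrib_left sum_distrib_left by (simp only: mult.left_commute)
    also have "\<dots> = expectation (\<lambda>\<omega>. ind k i \<omega> * ind r i \<omega>)
        + 2 * (\<Sum>j\<in>{1..<i}. expectation (\<lambda>\<omega>. ind k i \<omega> * ind r j \<omega>))"
      by (rule expectation_add_double_sum) (rule int2[OF r' k])+
    also have "\<dots> \<le> Qmax M d n m Y k + 2 * (\<Sum>j\<in>{1..<i}. Qmax M d n m Y k)"
      using i by (intro add_mono mult_left_mono sum_mono Qmax_ge[OF d_pos r]) auto
    also have "\<dots> = (2 * real i - 1) * Qmax M d n m Y k"
      using i by (simp add: of_nat_diff algebra_simps)
    finally show ?thesis .
  qed
  have "expectation (remainder i) = (\<Sum>k=1..n. p k i * (\<Sum>r\<in>nbhd n m k. expectation (weight i r))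
      + (\<Sum>r\<in>nbhd n m k - {k}. expectation (\<lambda>\<omega>. ind k i \<omega> * weight i r \<omega>)))"
  proof -
    have "integrable M (\<lambda>\<omega>. p k i * (\<Sum>r\<in>nbhd n m k. weight i r \<omega>))" for k
      using intw nbhd_subset by (intro integrable_mult_right Bochner_Integration.integrable_sum) blast
    moreover have "integrable M (\<lambda>\<omega>. \<Sum>r\<in>nbhd n m k - {k}. ind k i \<omega> * weight i r \<omega>)" if "k \<in> {1..n}" for k
      using intkw nbhd_subset that by (intro Bochner_Integration.integrable_sum) blast
    moreover have "expectation (\<lambda>\<omega>. \<Sum>r\<in>nbhd n m k. weight i r \<omega>) = (\<Sum>r\<in>nbhd n m k. expectation (weight i r))" for k
      using intw nbhd_subset by (intro Bochner_Integration.integral_sum) blast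
    moreover have "expectation (\<lambda>\<omega>. \<Sum>r\<in>nbhd n m k - {k}. ind k i \<omega> * weight i r \<omega>)
        = (\<Sum>r\<in>nbhd n m k - {k}. expectation (\<lambda>\<omega>. ind k i \<omega> * weight i r \<omega>))" if "k \<in> {1..n}" for k
      using intkw nbhd_subset that by (intro Bochner_Integration.integral_sum) blast
    ultimately show ?thesis
      unfolding remainder_def sum_distrib_left[of "ind _ i _"]
      by (subst Bochner_Integration.integral_sum)
         (auto intro!: sum.cong simp: Bochner_Integration.integral_add)
  qed
  also have "\<dots> \<le> coordinate_bound i"
    unfolding coordinate_bound_def
  proof (intro sum_mono add_mono)
    fix k assume k: "k \<in> {1..n}"
    show "p k i * (\<Sum>r\<in>nbhd n m k. expectation (weight i r))
      \<le> p k i * (\<Sum>r\<in>nbhd n m k. p r i + 2 * (\<Sum>j\<in>{1..<i}. p r j))"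
      using w by (auto simp: nbhd_def intro!: eq_refl arg_cong2[where f = "(*)"] sum.cong)
    have "(\<Sum>r\<in>nbhd n m k - {k}. expectation (\<lambda>\<omega>. ind k i \<omega> * weight i r \<omega>))
      \<le> real (card (nbhd n m k - {k})) * ((2 * real i - 1) * Qmax M d n m Y k)"
      by (rule sum_bounded_above) (rule kw[OF k])
    also have "\<dots> \<le> real (2 * m) * ((2 * real i - 1) * Qmax M d n m Y k)"
      using i Qmax_nonneg[OF d_pos] card_nbhd_minus
      by (intro mult_right_mono mult_nonneg_nonneg) (auto simp only: of_nat_le_iff, auto)
    finally show "(\<Sum>r\<in>nbhd n m k - {k}. expectation (\<lambda>\<omega>. ind k i \<omega> * weight i r \<omega>))
      \<le> 2 * real m * (2 * real i - 1) * Qmax M d n m Y k"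
      by (simp add: mult.assoc)
  qed
  finally show ?thesis .
qed

text \<open>Writing \<open>X i\<close> as a sum of indicators distributes the Stein expression over
  \<open>k\<close>; subtracting \<open>\<Phi> (W k)\<close> in each summand leaves increments of
  \<open>\<Phi>\<close> only.\<close>

lemma remainder_pathwise:
  fixes \<Phi> :: "(nat \<Rightarrow> nat) \<Rightarrow> real"
  assumes i: "i \<in> {1..d}" and \<omega>: "\<forall>r\<in>{1..n}. Y r \<omega> \<in> bernoulli_values d"
    and \<Phi>: "\<And>x y. \<bar>\<Phi> x - \<Phi> y\<bar>
      \<le> \<bar>real (x i) - real (y i)\<bar> + 2 * (\<Sum>j\<in>{1..<i}. \<bar>real (x j) - real (y j)\<bar>)"
  defines "X \<equiv> vsum Y {1..n} \<omega>" and "W k \<equiv> vsum Y ({1..n} - nbhd n m k) \<omega>"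
  shows "\<bar>((\<Sum>k=1..n. p k i) * \<Phi> X - real (X i) * \<Phi> (X(i := X i - 1)))
      - (\<Sum>k=1..n. (p k i - ind k i \<omega>) * \<Phi> (W k))\<bar> \<le> remainder i \<omega>"
proof -
  have Y: "real (Y r \<omega> j) = ind r j \<omega>" if "r \<in> {1..n}" "j \<in> {1..d}" for r j
    using \<omega> that bernoulli_values_component by blast
  have Xi: "real (X i) = (\<Sum>k=1..n. ind k i \<omega>)"
    unfolding X_def vsum_def of_nat_sum by (rule sum.cong) (use Y i in auto)
  have XW: "real (X j) - real (W k j) = (\<Sum>r\<in>nbhd n m k. ind r j \<omega>)" if "j \<in> {1..d}" for j k
  proof -
    have "real (X j) = real (W k j) + (\<Sum>r\<in>nbhd n m k. real (Y r \<omega> j))"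
      unfolding X_def W_def vsum_def of_nat_sum
      using sum.subset_diff[OF nbhd_subset, of "\<lambda>r. real (Y r \<omega> j)"] by simp
    moreover have "(\<Sum>r\<in>nbhd n m k. real (Y r \<omega> j)) = (\<Sum>r\<in>nbhd n m k. ind r j \<omega>)"
      using Y that by (intro sum.cong) (auto simp: nbhd_def)
    ultimately show ?thesis by simp
  qed
  have sw: "(\<Sum>r\<in>B. weight i r \<omega>) = (\<Sum>r\<in>B. ind r i \<omega>) + 2 * (\<Sum>j\<in>{1..<i}. \<Sum>r\<in>B. ind r j \<omega>)" for B
    unfolding weight_def sum.distrib sum_distrib_left[symmetric] by (subst (2) sum.swap) simp
  have ind_nonneg: "(\<Sum>r\<in>B. ind r j \<omega>) \<ge> 0" for B j by (rule sum_nonneg) simp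
  have 1: "\<bar>\<Phi> X - \<Phi> (W k)\<bar> \<le> (\<Sum>r\<in>nbhd n m k. weight i r \<omega>)" for k
  proof -
    have "(\<Sum>j\<in>{1..<i}. \<bar>real (X j) - real (W k j)\<bar>) = (\<Sum>j\<in>{1..<i}. \<Sum>r\<in>nbhd n m k. ind r j \<omega>)"
      using i XW ind_nonneg by (intro sum.cong) auto
    then show ?thesis using \<Phi>[of X "W k"] XW[OF i, of k] ind_nonneg[of i "nbhd n m k"] unfolding sw by simp
  qed
  \<comment> \<open>If \<open>Y k\<close> is not \<open>e_i\<close>, both sides vanish. Otherwise
    lowering coordinate \<open>i\<close> removes exactly \<open>Y k\<close> from \<open>X\<close>,
    so only the other neighbours separate the result from \<open>W k\<close>.\<close>
  have 2: "\<bar>ind k i \<omega> * (\<Phi> (X(i := X i - 1)) - \<Phi> (W k))\<bar>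
      \<le> ind k i \<omega> * (\<Sum>r\<in>nbhd n m k - {k}. weight i r \<omega>)" if k: "k \<in> {1..n}" for k
  proof (cases "Y k \<omega> = basis_vec d i")
    case True
    have kn: "k \<in> nbhd n m k" using k by (simp add: nbhd_def)
    have fin: "finite (nbhd n m k)" by (simp add: nbhd_def)
    have split: "(\<Sum>r\<in>nbhd n m k. ind r j \<omega>) = ind k j \<omega> + (\<Sum>r\<in>nbhd n m k - {k}. ind r j \<omega>)" for j
      by (rule sum.remove[OF fin kn])
    have ki: "ind k i \<omega> = 1" using True by simp
    have kj: "ind k j \<omega> = 0" if "j \<in> {1..<i}" for j
      using True that i basis_vec_eq_iff[of i d j] by (simp add: indicator_def)
    \<comment> \<open>\<open>Y k\<close> contributes one unit, hence the truncated subtraction is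
      exact.\<close>
    have "1 \<le> real (X i)"
      using XW[OF i, of k] ki split[of i] ind_nonneg[of i "nbhd n m k - {k}"] by simp
    then have "real (X i - 1) = real (X i) - 1" by (simp add: of_nat_diff)
    then have "real ((X(i := X i - 1)) i) - real (W k i) = (\<Sum>r\<in>nbhd n m k - {k}. ind r i \<omega>)"
      using XW[OF i, of k] ki split[of i] by simp
    moreover have "(\<Sum>j\<in>{1..<i}. \<bar>real ((X(i := X i - 1)) j) - real (W k j)\<bar>)
        = (\<Sum>j\<in>{1..<i}. \<Sum>r\<in>nbhd n m k - {k}. ind r j \<omega>)"
    proof (rule sum.cong)
      fix j assume j: "j \<in> {1..<i}"
      then have "real (X j) - real (W k j) = (\<Sum>r\<in>nbhd n m k - {k}. ind r j \<omega>)"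
        using i XW[of j k] kj[OF j] split[of j] by auto
      then show "\<bar>real ((X(i := X i - 1)) j) - real (W k j)\<bar> = (\<Sum>r\<in>nbhd n m k - {k}. ind r j \<omega>)"
        using j ind_nonneg[of j "nbhd n m k - {k}"] by simp
    qed simp
    ultimately show ?thesis
      using \<Phi>[of "X(i := X i - 1)" "W k"] ind_nonneg[of i "nbhd n m k - {k}"] unfolding sw ki by simp
  qed simp
  have regroup: "((\<Sum>k=1..n. q k) * a - (\<Sum>k=1..n. v k) * b) - (\<Sum>k=1..n. (q k - v k) * w k)
      = (\<Sum>k=1..n. q k * (a - w k) - v k * (b - w k))" for q v w :: "nat \<Rightarrow> real" and a b
    unfolding sum_distrib_right sum_subtractf[symmetric]
    by (rule sum.cong) (simp_all add: algebra_simps)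
  have "((\<Sum>k=1..n. p k i) * \<Phi> X - real (X i) * \<Phi> (X(i := X i - 1)))
      - (\<Sum>k=1..n. (p k i - ind k i \<omega>) * \<Phi> (W k))
    = (\<Sum>k=1..n. p k i * (\<Phi> X - \<Phi> (W k)) - ind k i \<omega> * (\<Phi> (X(i := X i - 1)) - \<Phi> (W k)))"
    unfolding Xi by (rule regroup)
  then have "\<bar>((\<Sum>k=1..n. p k i) * \<Phi> X - real (X i) * \<Phi> (X(i := X i - 1)))
      - (\<Sum>k=1..n. (p k i - ind k i \<omega>) * \<Phi> (W k))\<bar>
    \<le> (\<Sum>k=1..n. \<bar>p k i * (\<Phi> X - \<Phi> (W k)) - ind k i \<omega> * (\<Phi> (X(i := X i - 1)) - \<Phi> (W k))\<bar>)"
    by (simp only: sum_abs)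
  also have "\<dots> \<le> remainder i \<omega>"
    unfolding remainder_def
  proof (rule sum_mono)
    fix k assume k: "k \<in> {1..n}"
    have "\<bar>p k i * (\<Phi> X - \<Phi> (W k))\<bar> \<le> p k i * (\<Sum>r\<in>nbhd n m k. weight i r \<omega>)"
      unfolding abs_mult abs_of_nonneg[OF p_nonneg[OF k i]]
      by (rule mult_left_mono[OF 1 p_nonneg[OF k i]])
    then show "\<bar>p k i * (\<Phi> X - \<Phi> (W k)) - ind k i \<omega> * (\<Phi> (X(i := X i - 1)) - \<Phi> (W k))\<bar>
      \<le> p k i * (\<Sum>r\<in>nbhd n m k. weight i r \<omega>) + ind k i \<omega> * (\<Sum>r\<in>nbhd n m k - {k}. weight i r \<omega>)"
      by (rule order_trans[OF abs_triangle_ineq4 add_mono[OF _ 2[OF k]]])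
  qed
  finally show ?thesis .
qed

text \<open>The Stein equation turns the difference into the expectation of \<open>A\<close>.
  Subtracting the mean-zero \<open>B\<close> costs nothing and makes the pathwise estimate
  applicable.\<close>

lemma coordinate_replacement:
  assumes i: "i \<in> {1..d}" and g: "lip i g"
  defines "l \<equiv> (\<Sum>k=1..n. p k i)"
  shows "\<bar>expectation (\<lambda>\<omega>. g (vsum Y {1..n} \<omega>)) - expectation (\<lambda>\<omega>. avg i l g (vsum Y {1..n} \<omega>))\<bar>
    \<le> coordinate_bound i"
proof -
  have i1: "i \<ge> 1" using i by simp
  have l: "l \<ge> 0" unfolding l_def using p_nonneg i by (intro sum_nonneg) auto
  define \<Phi> where "\<Phi> = stein_fun i l g"
  have \<Phi>: "\<bar>\<Phi> x - \<Phi> y\<bar>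
      \<le> \<bar>real (x i) - real (y i)\<bar> + 2 * (\<Sum>j\<in>{1..<i}. \<bar>real (x j) - real (y j)\<bar>)" for x y
    unfolding \<Phi>_def by (rule stein_fun_lipschitz[OF g i1 l])
  define X where "X = vsum Y {1..n}"
  define W where "W k = vsum Y ({1..n} - nbhd n m k)" for k
  have det: "vsum Y D \<omega> = vsum Y D \<omega>'" if "D \<subseteq> {1..n}" "\<And>r. r \<in> {1..n} \<Longrightarrow> Y r \<omega> = Y r \<omega>'" for D \<omega> \<omega>'
    unfolding vsum_def using that by (intro ext sum.cong) auto
  have intX: "integrable M (\<lambda>\<omega>. \<phi> (X \<omega>))" for \<phi> :: "(nat \<Rightarrow> nat) \<Rightarrow> real"
    unfolding X_def by (intro integrable_if_determined arg_cong[where f = \<phi>] det) auto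
  have intW: "integrable M (\<lambda>\<omega>. \<Phi> (W k \<omega>))" for k
    unfolding W_def by (intro integrable_if_determined arg_cong[where f = \<Phi>] det) auto
  have intVW: "integrable M (\<lambda>\<omega>. ind k i \<omega> * \<Phi> (W k \<omega>))" if "k \<in> {1..n}" for k
  proof (rule integrable_if_determined)
    fix \<omega> \<omega>' assume eq: "\<And>r. r \<in> {1..n} \<Longrightarrow> Y r \<omega> = Y r \<omega>'"
    then have "W k \<omega> = W k \<omega>'" unfolding W_def by (intro det) auto
    then show "ind k i \<omega> * \<Phi> (W k \<omega>) = ind k i \<omega>' * \<Phi> (W k \<omega>')" using eq[OF that] by simp
  qed
  define A where "A \<omega> = l * \<Phi> (X \<omega>) - real (X \<omega> i) * \<Phi> ((X \<omega>)(i := X \<omega> i - 1))" for \<omega>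
  define B where "B \<omega> = (\<Sum>k=1..n. (p k i - ind k i \<omega>) * \<Phi> (W k \<omega>))" for \<omega>
  have intA: "integrable M A"
    using intX[of "\<lambda>x. l * \<Phi> x - real (x i) * \<Phi> (x(i := x i - 1))"] by (simp add: A_def[abs_def])
  have intB: "integrable M B" and EB: "expectation B = 0"
  proof -
    \<comment> \<open>\<open>W k\<close> is independent of the event \<open>Y k = e_i\<close>, whose
      probability is \<open>p k i\<close>, so the two halves cancel.\<close>
    have summand: "integrable M (\<lambda>\<omega>. (p k i - ind k i \<omega>) * \<Phi> (W k \<omega>))
        \<and> expectation (\<lambda>\<omega>. (p k i - ind k i \<omega>) * \<Phi> (W k \<omega>)) = 0" if k: "k \<in> {1..n}" for k
      using expectation_indep_far[OF k i, of \<Phi>] intW intVW[OF k]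
      by (simp add: left_diff_distrib W_def Bochner_Integration.integral_diff)
    then show "integrable M B" unfolding B_def[abs_def] by (intro Bochner_Integration.integrable_sum) auto
    show "expectation B = 0"
      unfolding B_def[abs_def] using summand by (subst Bochner_Integration.integral_sum) auto
  qed
  have "expectation (\<lambda>\<omega>. g (X \<omega>)) - expectation (\<lambda>\<omega>. avg i l g (X \<omega>)) = expectation A"
    unfolding A_def[abs_def] \<Phi>_def stein_fun_eq[OF g i1 l]
    by (simp add: Bochner_Integration.integral_diff intX)
  also have "\<dots> = expectation (\<lambda>\<omega>. A \<omega> - B \<omega>)"
    by (simp add: Bochner_Integration.integral_diff intA intB EB)
  also have "\<bar>\<dots>\<bar> \<le> expectation (\<lambda>\<omega>. \<bar>A \<omega> - B \<omega>\<bar>)"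
    by (rule integral_abs_bound)
  also have "\<dots> \<le> expectation (remainder i)"
  proof (rule integral_mono_AE)
    show "AE \<omega> in M. \<bar>A \<omega> - B \<omega>\<bar> \<le> remainder i \<omega>"
      using AE_bernoulli
    proof eventually_elim
      case (elim \<omega>)
      show ?case
        unfolding A_def B_def X_def W_def l_def by (rule remainder_pathwise[OF i elim \<Phi>])
    qed
  qed (intro integrable_abs Bochner_Integration.integrable_diff intA intB integrable_remainder)+
  also have "\<dots> \<le> coordinate_bound i"
    by (rule expectation_remainder[OF i])
  finally show ?thesis unfolding X_def .
qed

text \<open>The odd numbers \<open>2 * i - 1\<close> add up to \<open>d ^ 2\<close>, which is at
  most \<open>d * (d + 1)\<close>; nonnegativity of \<open>Qmax\<close> lets this enlarge the
  bound.\<close>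

lemma sum_coordinate_bound:
  "(\<Sum>i=1..d. coordinate_bound i)
    \<le> (\<Sum>k=1..n. \<Sum>i=1..d.
          ((\<Sum>r\<in>nbhd n m k. p r i) + 2 * (\<Sum>j\<in>{1..<i}. \<Sum>r\<in>nbhd n m k. p r j)) * p k i)
       + 2 * real d * (real d + 1) * real m * (\<Sum>k=1..n. Qmax M d n m Y k)"
proof -
  define A where "A k i = ((\<Sum>r\<in>nbhd n m k. p r i) + 2 * (\<Sum>j\<in>{1..<i}. \<Sum>r\<in>nbhd n m k. p r j)) * p k i" for k i
  define Q where "Q = (\<Sum>k=1..n. Qmax M d n m Y k)"
  have A: "p k i * (\<Sum>r\<in>nbhd n m k. p r i + 2 * (\<Sum>j\<in>{1..<i}. p r j)) = A k i" for k i
  proof -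
    have "(\<Sum>r\<in>nbhd n m k. \<Sum>j\<in>{1..<i}. p r j) = (\<Sum>j\<in>{1..<i}. \<Sum>r\<in>nbhd n m k. p r j)"
      by (rule sum.swap)
    then show ?thesis by (simp add: A_def sum.distrib sum_distrib_left[symmetric])
  qed
  have odd: "(\<Sum>i=1..e. 2 * real i - 1) = real e ^ 2" for e
    by (induction e) (auto simp: power2_eq_square algebra_simps)
  have "coordinate_bound i = (\<Sum>k=1..n. A k i) + (2 * real i - 1) * (2 * real m * Q)" for i
    unfolding coordinate_bound_def A Q_def
    unfolding sum.distrib sum_distrib_left by (simp only: mult_ac)
  then have "(\<Sum>i=1..d. coordinate_bound i) = (\<Sum>i=1..d. (\<Sum>k=1..n. A k i) + (2 * real i - 1) * (2 * real m * Q))"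
    by simp
  also have "\<dots> = (\<Sum>k=1..n. \<Sum>i=1..d. A k i) + real d ^ 2 * (2 * real m * Q)"
    unfolding sum.distrib sum_distrib_right[symmetric] odd by (subst sum.swap) (rule refl)
  also have "real d ^ 2 * (2 * real m * Q) \<le> 2 * real d * (real d + 1) * real m * Q"
  proof -
    have "Q \<ge> 0" unfolding Q_def using Qmax_nonneg[OF d_pos] by (intro sum_nonneg) auto
    then have "0 \<le> 2 * real d * real m * Q" by simp
    then show ?thesis by (simp add: power2_eq_square algebra_simps)
  qed
  finally show ?thesis by (simp add: A_def Q_def)
qed

end

section \<open>The bound on the Wasserstein distance\<close>

lemma lip_restrict:
  assumes "g \<in> lipschitz1 d"
  shows "lip d (\<lambda>x. g (restrict x {1..d}))"
  unfolding lip_def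
proof (intro allI)
  fix x y :: "nat \<Rightarrow> nat"
  have "restrict x {1..d} \<in> space (nvec d)" "restrict y {1..d} \<in> space (nvec d)"
    by (auto simp: nvec_eq_count_space)
  then have "\<bar>g (restrict x {1..d}) - g (restrict y {1..d})\<bar>
      \<le> (\<Sum>i=1..d. \<bar>real (restrict x {1..d} i) - real (restrict y {1..d} i)\<bar>)"
    using assms unfolding lipschitz1_def by blast
  then show "\<bar>g (restrict x {1..d}) - g (restrict y {1..d})\<bar> \<le> (\<Sum>j=1..d. \<bar>real (x j) - real (y j)\<bar>)"
    by simp
qed

theorem theorem3p1:
  fixes n d m :: nat
    and M :: "'a measure" and N :: "'b measure"
    and Y :: "nat \<Rightarrow> 'a \<Rightarrow> nat \<Rightarrow> nat"
    and P :: "'b \<Rightarrow> nat \<Rightarrow> nat"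
    and p :: "nat \<Rightarrow> nat \<Rightarrow> real"
  assumes "n \<ge> 1" and "d \<ge> 1"
    and "prob_space M" and "prob_space N"
    and "\<And>r. r \<in> {1..n} \<Longrightarrow> Y r \<in> measurable M (nvec d)"
    and "m_dependent M (nvec d) m n Y"
    and "\<And>r j. r \<in> {1..n} \<Longrightarrow> j \<in> {1..d} \<Longrightarrow> p r j \<in> {0..1}"
    and "\<And>r. r \<in> {1..n} \<Longrightarrow> 1 - (\<Sum>j=1..d. p r j) \<in> {0..1}"
    and "\<And>r j. r \<in> {1..n} \<Longrightarrow> j \<in> {1..d} \<Longrightarrow>
           measure M {\<omega> \<in> space M. Y r \<omega> = basis_vec d j} = p r j"
    and "\<And>r. r \<in> {1..n} \<Longrightarrow>
           measure M {\<omega> \<in> space M. Y r \<omega> = zero_vec d} = 1 - (\<Sum>j=1..d. p r j)"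
    and "poisson_vector N d P"
    and "\<And>j. j \<in> {1..d} \<Longrightarrow> (LINT \<omega>|N. real (P \<omega> j)) = (\<Sum>r=1..n. p r j)"
  shows "dW d M (sum_vec d n Y) N P \<le>
    ereal ((\<Sum>k=1..n. \<Sum>i=1..d.
              ((\<Sum>r\<in>nbhd n m k. p r i) + 2 * (\<Sum>j\<in>{1..<i}. \<Sum>r\<in>nbhd n m k. p r j)) * p k i)
           + 2 * real d * (real d + 1) * real m * (\<Sum>k=1..n. Qmax M d n m Y k))"
  unfolding dW_def
proof (rule SUP_least)
  fix g assume g: "g \<in> lipschitz1 d"
  interpret prob_space M by fact
  interpret bernoulli_vectors M n d m Y p
    by unfold_locales (use assms in auto)
  \<comment> \<open>\<open>g\<close> is controlled on extensional vectors only. Restricting the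
    argument makes it Lipschitz on all functions and keeps its values at \<open>P \<omega>\<close>,
    which is extensional.\<close>
  define g' where "g' x = g (restrict x {1..d})" for x
  define l where "l j = (\<Sum>r=1..n. p r j)" for j
  have lip: "lip d g'" unfolding g'_def[abs_def] by (rule lip_restrict[OF g])
  have P: "P \<in> measurable N (nvec d)" using assms by (simp add: poisson_vector_def)
  have "(LINT \<omega>|N. g (P \<omega>)) = (LINT \<omega>|N. g' (P \<omega>))"
  proof (rule Bochner_Integration.integral_cong)
    fix \<omega> assume "\<omega> \<in> space N"
    then have "P \<omega> \<in> PiE {1..d} (\<lambda>_. UNIV)"
      using measurable_space[OF P] by (simp add: nvec_eq_count_space)
    then show "g (P \<omega>) = g' (P \<omega>)" by (simp add: g'_def PiE_restrict)
  qed simp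
  also have "\<dots> = (LINT x|poisson_product d l. g' x)"
    by (rule integral_poisson_vector) (use assms in \<open>auto simp: l_def\<close>)
  moreover have "(LINT \<omega>|M. g (sum_vec d n Y \<omega>)) = (LINT \<omega>|M. g' (vsum Y {1..n} \<omega>))"
    unfolding g'_def sum_vec_def vsum_def ..
  moreover have "\<bar>(LINT \<omega>|M. g' (vsum Y {1..n} \<omega>)) - (LINT x|poisson_product d l. g' x)\<bar>
      \<le> (\<Sum>i=1..d. coordinate_bound i)"
  proof (rule lindeberg_telescoping[where d = d])
    show "l j \<ge> 0" if "j \<in> {1..d}" for j
      unfolding l_def using that p_nonneg by (intro sum_nonneg) auto
  qed (use coordinate_replacement lip in \<open>auto simp: l_def prob_space_axioms\<close>)
  ultimately show "ereal \<bar>(LINT \<omega>|M. g (sum_vec d n Y \<omega>)) - (LINT \<omega>|N. g (P \<omega>))\<bar> \<le>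
    ereal ((\<Sum>k=1..n. \<Sum>i=1..d.
              ((\<Sum>r\<in>nbhd n m k. p r i) + 2 * (\<Sum>j\<in>{1..<i}. \<Sum>r\<in>nbhd n m k. p r j)) * p k i)
           + 2 * real d * (real d + 1) * real m * (\<Sum>k=1..n. Qmax M d n m Y k))"
    using sum_coordinate_bound by simp
qed

end
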